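(* Let $k$ be a commutative ring. If $\mathscr{C}$ is $\mathrm{OA}$ or $\mathrm{BA}$, then $\Delta_n\cong k\mathscr{C}\Psi_n$ as $\mathscr{C}$-modules for every $n\geq1$, and hence $\Delta_n$ is projective. If $\mathscr{C}$ is $\mathrm{CA}$ or $\mathrm{SA}$, then for $n\geq3$ there exists a short exact sequence of $\mathscr{C}$-modules $$0\to\Delta_{n-1}\to k\mathscr{C}\Psi_n\to\Delta_n\to0.$$
   Context: For $n\geq1$ put $[n]=\{1,\dots,n\}$. The categories have objects $[n]$, $n\in\mathbb{Z}_{+}=\{1,2,\dots\}$, and morphisms: $\mathrm{OA}$ (simplex category): weakly order-preserving maps; $\mathrm{CA}$: maps preserving the cyclic order, i.e. maps $\sigma\circ g\circ\rho$ with $\rho,\sigma$ rotations (powers of the standard cyclic permutation) of source and target and $g$ weakly order-preserving; $\mathrm{BA}$: maps preserving linear betweenness, i.e. weakly order-preserving or weakly order-reversing maps; $\mathrm{SA}$: maps preserving the separation relation, i.e. maps $f:[m]\to[n]$ such that $f$ or its composite with the reversal $i\mapsto n+1-i$ of $[n]$ lies in $\mathrm{CA}$. A $\mathscr{C}$-module is a covariant functor $\mathscr{C}\to k\text{-}\mathrm{Mod}$. The standard module $\Delta_n$ is the quotient of the representable functor $P_n=k\mathscr{C}(n,-)$ by the submodule spanned by all non-injective morphisms with source $[n]$. Let $d_i:[n-1]\to[n]$ be the injection $d_i(j)=j$ for $j<i$, $d_i(j)=j+1$ for $j\geq i$, and $s_i:[n]\to[n-1]$ ($i<n$) the surjection $s_i(j)=j$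 for $j\leq i$, $s_i(j)=j-1$ for $j>i$. Set $$\Psi_n=(\mathrm{id}_n-d_{n-1}s_{n-1})(\mathrm{id}_n-d_{n-2}s_{n-2})\cdots(\mathrm{id}_n-d_1s_1)\in k\,\mathrm{OA}(n,n)\subseteq k\mathscr{C}(n,n),\quad\Psi_1=\mathrm{id}_{[1]};$$ this is an idempotent. $k\mathscr{C}\Psi_n=\{x\Psi_n: x\in k\mathscr{C}(n,-)\}$ is the submodule of $P_n$ generated by $\Psi_n$ (a direct summand of $P_n$).
   Formalization: The factors of Ψ_n are taken in the opposite order, Ψ_n=(id−d_1s_1)(id−d_2s_2)…(id−d_{n−1}s_{n−1}); with the displayed order Ψ_n is not idempotent for n≥3 and the claim fails (e.g. OA, n=3, at the object [2]). *)

theory Defs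
  imports "HOL-Algebra.Module" "HOL-Algebra.AbelCoset" HOL.Hull
begin

section \<open>The categories\<close>

text \<open>
  The objects are the natural numbers \<open>n \<ge> 1\<close>, standing for \<open>{1..n}\<close>. A category is given by its
  hom-sets: \<open>C m n\<close> consists of extensional functions from \<open>{1..m}\<close> to \<open>{1..n}\<close>. The composite of
  \<open>f \<in> C l m\<close> and \<open>g \<in> C m n\<close> is \<open>compose {1..l} g f\<close>, the identity of \<open>n\<close> is \<open>\<lambda>i\<in>{1..n}. i\<close>.
\<close>

type_synonym homsets = "nat \<Rightarrow> nat \<Rightarrow> (nat \<Rightarrow> nat) set"

definition OA :: homsets where
  "OA m n = {f \<in> {1..m} \<rightarrow>\<^sub>E {1..n}. mono_on {1..m} f}"

definition BA :: homsets where
  "BA m n = {f \<in> {1..m} \<rightarrow>\<^sub>E {1..n}. mono_on {1..m} f \<or> antimono_on {1..m} f}"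

text \<open>The \<open>r\<close>-th power of the cyclic permutation \<open>1 \<mapsto> 2 \<mapsto> \<dots> \<mapsto> n \<mapsto> 1\<close>.\<close>

definition rotation :: "nat \<Rightarrow> nat \<Rightarrow> nat \<Rightarrow> nat" where
  "rotation n r = restrict ((\<lambda>i. i mod n + 1) ^^ r) {1..n}"

definition CA :: homsets where
  "CA m n = {compose {1..m} (rotation n s) (compose {1..m} g (rotation m r)) | r s g. g \<in> OA m n}"

definition reversal :: "nat \<Rightarrow> nat \<Rightarrow> nat" where
  "reversal n = (\<lambda>i\<in>{1..n}. n + 1 - i)"

definition SA :: homsets where
  "SA m n = {f \<in> {1..m} \<rightarrow>\<^sub>E {1..n}. f \<in> CA m n \<or> compose {1..m} (reversal n) f \<in> CA m n}"


section \<open>Modules over a category\<close>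

definition linear_maps ::
  "('r, 'm) ring_scheme \<Rightarrow> ('r, 'a) module \<Rightarrow> ('r, 'b) module \<Rightarrow> ('a \<Rightarrow> 'b) set" where
  "linear_maps k M N = {h \<in> carrier M \<rightarrow> carrier N.
     (\<forall>x\<in>carrier M. \<forall>y\<in>carrier M. h (x \<oplus>\<^bsub>M\<^esub> y) = h x \<oplus>\<^bsub>N\<^esub> h y) \<and>
     (\<forall>a\<in>carrier k. \<forall>x\<in>carrier M. h (a \<odot>\<^bsub>M\<^esub> x) = a \<odot>\<^bsub>N\<^esub> h x)}"

text \<open>
  The action takes source and target explicitly, since an extensional function does not determine
  them.
\<close>

record ('r, 'a) cat_module =
  obj :: "nat \<Rightarrow> ('r, 'a) module"
  act :: "nat \<Rightarrow> nat \<Rightarrow> (nat \<Rightarrow> nat) \<Rightarrow> 'a \<Rightarrow> 'a"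

definition is_cat_module ::
  "('r, 'm) ring_scheme \<Rightarrow> homsets \<Rightarrow> ('r, 'a) cat_module \<Rightarrow> bool" where
  "is_cat_module k C M \<longleftrightarrow>
     (\<forall>n\<ge>1. module k (obj M n)) \<and>
     (\<forall>m\<ge>1. \<forall>n\<ge>1. \<forall>f\<in>C m n. act M m n f \<in> linear_maps k (obj M m) (obj M n)) \<and>
     (\<forall>n\<ge>1. \<forall>x\<in>carrier (obj M n). act M n n (\<lambda>i\<in>{1..n}. i) x = x) \<and>
     (\<forall>l\<ge>1. \<forall>m\<ge>1. \<forall>n\<ge>1. \<forall>f\<in>C l m. \<forall>g\<in>C m n. \<forall>x\<in>carrier (obj M l).
        act M l n (compose {1..l} g f) x = act M m n g (act M l m f x))"

definition cat_module_hom ::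
  "('r, 'm) ring_scheme \<Rightarrow> homsets \<Rightarrow> ('r, 'a) cat_module \<Rightarrow> ('r, 'b) cat_module \<Rightarrow>
     (nat \<Rightarrow> 'a \<Rightarrow> 'b) set" where
  "cat_module_hom k C M N = {\<eta>.
     (\<forall>n\<ge>1. \<eta> n \<in> linear_maps k (obj M n) (obj N n)) \<and>
     (\<forall>m\<ge>1. \<forall>n\<ge>1. \<forall>f\<in>C m n. \<forall>x\<in>carrier (obj M m).
        \<eta> n (act M m n f x) = act N m n f (\<eta> m x))}"

definition cat_module_iso ::
  "('r, 'm) ring_scheme \<Rightarrow> homsets \<Rightarrow> ('r, 'a) cat_module \<Rightarrow> ('r, 'b) cat_module \<Rightarrow> bool" where
  "cat_module_iso k C M N \<longleftrightarrow>
     is_cat_module k C M \<and> is_cat_module k C N \<and>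
     (\<exists>\<eta>\<in>cat_module_hom k C M N.
        \<forall>n\<ge>1. bij_betw (\<eta> n) (carrier (obj M n)) (carrier (obj N n)))"

definition short_exact ::
  "('r, 'm) ring_scheme \<Rightarrow> homsets \<Rightarrow> ('r, 'a) cat_module \<Rightarrow> ('r, 'b) cat_module \<Rightarrow>
     ('r, 'c) cat_module \<Rightarrow> (nat \<Rightarrow> 'a \<Rightarrow> 'b) \<Rightarrow> (nat \<Rightarrow> 'b \<Rightarrow> 'c) \<Rightarrow> bool" where
  "short_exact k C L M N \<alpha> \<beta> \<longleftrightarrow>
     is_cat_module k C L \<and> is_cat_module k C M \<and> is_cat_module k C N \<and>
     \<alpha> \<in> cat_module_hom k C L M \<and> \<beta> \<in> cat_module_hom k C M N \<and>
     (\<forall>n\<ge>1. inj_on (\<alpha> n) (carrier (obj L n)) \<and>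
            \<alpha> n ` carrier (obj L n) = a_kernel (obj M n) (obj N n) (\<beta> n) \<and>
            \<beta> n ` carrier (obj M n) = carrier (obj N n))"

text \<open>
  The lifting property against all surjections \<open>\<eta> : M \<rightarrow> N\<close>. A definition cannot quantify over
  types, so the element types of \<open>M\<close> and \<open>N\<close> are parameters; leaving them as type variables in a
  theorem makes the statement range over all of them.
\<close>

definition projective ::
  "'b itself \<Rightarrow> 'c itself \<Rightarrow> ('r, 'm) ring_scheme \<Rightarrow> homsets \<Rightarrow> ('r, 'a) cat_module \<Rightarrow> bool" where
  "projective _ _ k C P \<longleftrightarrow>
     is_cat_module k C P \<and>
     (\<forall>(M :: ('r, 'b) cat_module) (N :: ('r, 'c) cat_module).
        is_cat_module k C M \<longrightarrow> is_cat_module k C N \<longrightarrow>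
        (\<forall>\<eta>\<in>cat_module_hom k C M N. \<forall>\<phi>\<in>cat_module_hom k C P N.
           (\<forall>n\<ge>1. \<eta> n ` carrier (obj M n) = carrier (obj N n)) \<longrightarrow>
           (\<exists>\<psi>\<in>cat_module_hom k C P M.
              \<forall>n\<ge>1. \<forall>x\<in>carrier (obj P n). \<eta> n (\<psi> n x) = \<phi> n x)))"

definition sub_cat_module ::
  "('r, 'a) cat_module \<Rightarrow> (nat \<Rightarrow> 'a set) \<Rightarrow> ('r, 'a) cat_module" where
  "sub_cat_module M S = \<lparr>obj = \<lambda>n. (obj M n)\<lparr>carrier := S n\<rparr>, act = act M\<rparr>"

text \<open>Multiplication and unit of the underlying ring record play no role in a module.\<close>

definition quot_module :: "('r, 'a) module \<Rightarrow> 'a set \<Rightarrow> ('r, 'a set) module" where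
  "quot_module M H = \<lparr>carrier = a_rcosets\<^bsub>M\<^esub> H, mult = undefined, one = undefined,
     zero = H, add = set_add M, smult = \<lambda>a X. \<Union>x\<in>X. H +>\<^bsub>M\<^esub> (a \<odot>\<^bsub>M\<^esub> x)\<rparr>"

definition quot_cat_module ::
  "('r, 'a) cat_module \<Rightarrow> (nat \<Rightarrow> 'a set) \<Rightarrow> ('r, 'a set) cat_module" where
  "quot_cat_module M S = \<lparr>obj = \<lambda>n. quot_module (obj M n) (S n),
     act = \<lambda>m n f X. \<Union>x\<in>X. S n +>\<^bsub>obj M n\<^esub> act M m n f x\<rparr>"


section \<open>The linearised category\<close>

text \<open>
  For a finite set \<open>S\<close>, the free module \<open>kS\<close>: an element is the family of its coefficients.
\<close>

definition free_module :: "('r, 'm) ring_scheme \<Rightarrow> 's set \<Rightarrow> ('r, 's \<Rightarrow> 'r) module" where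
  "free_module k S = \<lparr>carrier = S \<rightarrow>\<^sub>E carrier k, mult = undefined, one = undefined,
     zero = (\<lambda>s\<in>S. \<zero>\<^bsub>k\<^esub>), add = (\<lambda>x y. \<lambda>s\<in>S. x s \<oplus>\<^bsub>k\<^esub> y s),
     smult = (\<lambda>a x. \<lambda>s\<in>S. a \<otimes>\<^bsub>k\<^esub> x s)\<rparr>"

definition basis :: "('r, 'm) ring_scheme \<Rightarrow> 's set \<Rightarrow> 's \<Rightarrow> 's \<Rightarrow> 'r" where
  "basis k S s = (\<lambda>t\<in>S. if t = s then \<one>\<^bsub>k\<^esub> else \<zero>\<^bsub>k\<^esub>)"

text \<open>The bilinear extension \<open>y x\<close> of composition to \<open>y \<in> kC(m,n)\<close> and \<open>x \<in> kC(l,m)\<close>.\<close>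

definition lin_comp ::
  "('r, 'm) ring_scheme \<Rightarrow> homsets \<Rightarrow> nat \<Rightarrow> nat \<Rightarrow> nat \<Rightarrow>
     ((nat \<Rightarrow> nat) \<Rightarrow> 'r) \<Rightarrow> ((nat \<Rightarrow> nat) \<Rightarrow> 'r) \<Rightarrow> ((nat \<Rightarrow> nat) \<Rightarrow> 'r)" where
  "lin_comp k C l m n y x = (\<lambda>h\<in>C l n.
     \<Oplus>\<^bsub>k\<^esub>p\<in>{(g, f). g \<in> C m n \<and> f \<in> C l m \<and> compose {1..l} g f = h}. y (fst p) \<otimes>\<^bsub>k\<^esub> x (snd p))"

definition representable ::
  "('r, 'm) ring_scheme \<Rightarrow> homsets \<Rightarrow> nat \<Rightarrow> ('r, (nat \<Rightarrow> nat) \<Rightarrow> 'r) cat_module" where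
  "representable k C n = \<lparr>obj = \<lambda>l. free_module k (C n l),
     act = \<lambda>l m f x. lin_comp k C n l m (basis k (C l m) f) x\<rparr>"

definition noninjective_span ::
  "('r, 'm) ring_scheme \<Rightarrow> homsets \<Rightarrow> nat \<Rightarrow> nat \<Rightarrow> ((nat \<Rightarrow> nat) \<Rightarrow> 'r) set" where
  "noninjective_span k C n l = (\<lambda>H. submodule H k (free_module k (C n l))) hull
     (basis k (C n l) ` {f \<in> C n l. \<not> inj_on f {1..n}})"

definition standard_module ::
  "('r, 'm) ring_scheme \<Rightarrow> homsets \<Rightarrow> nat \<Rightarrow> ('r, ((nat \<Rightarrow> nat) \<Rightarrow> 'r) set) cat_module" where
  "standard_module k C n = quot_cat_module (representable k C n) (noninjective_span k C n)"


section \<open>The idempotent\<close>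

definition coface :: "nat \<Rightarrow> nat \<Rightarrow> nat \<Rightarrow> nat" where
  "coface n i = (\<lambda>j\<in>{1..n - 1}. if j < i then j else j + 1)"

definition codegeneracy :: "nat \<Rightarrow> nat \<Rightarrow> nat \<Rightarrow> nat" where
  "codegeneracy n i = (\<lambda>j\<in>{1..n}. if j \<le> i then j else j - 1)"

text \<open>
  The map \<open>d\<^sub>i s\<^sub>i\<close> sends \<open>i\<close> to \<open>i + 1\<close> and fixes everything else. With products taken as composites
  of maps (the right factor is applied first), the order of the factors matters:
  \<open>(1 - d\<^sub>1 s\<^sub>1) (1 - d\<^sub>2 s\<^sub>2) \<dots> (1 - d\<^sub>n\<^sub>-\<^sub>1 s\<^sub>n\<^sub>-\<^sub>1)\<close> is an idempotent annihilated on the left by every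
  non-injective order-preserving map, whereas the product in the opposite order is not idempotent for
  \<open>n \<ge> 3\<close> (over a nonzero ring). \<open>Psi_partial k C n j\<close> is the product of the first \<open>j\<close> factors.
\<close>

primrec Psi_partial ::
  "('r, 'm) ring_scheme \<Rightarrow> homsets \<Rightarrow> nat \<Rightarrow> nat \<Rightarrow> (nat \<Rightarrow> nat) \<Rightarrow> 'r" where
  "Psi_partial k C n 0 = basis k (C n n) (\<lambda>i\<in>{1..n}. i)"
| "Psi_partial k C n (Suc j) = lin_comp k C n n n (Psi_partial k C n j)
     (basis k (C n n) (\<lambda>i\<in>{1..n}. i) \<ominus>\<^bsub>free_module k (C n n)\<^esub>
      basis k (C n n) (compose {1..n} (coface n (Suc j)) (codegeneracy n (Suc j))))"

definition Psi :: "('r, 'm) ring_scheme \<Rightarrow> homsets \<Rightarrow> nat \<Rightarrow> (nat \<Rightarrow> nat) \<Rightarrow> 'r" where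
  "Psi k C n = Psi_partial k C n (n - 1)"

definition Psi_module ::
  "('r, 'm) ring_scheme \<Rightarrow> homsets \<Rightarrow> nat \<Rightarrow> ('r, (nat \<Rightarrow> nat) \<Rightarrow> 'r) cat_module" where
  "Psi_module k C n = sub_cat_module (representable k C n)
     (\<lambda>l. {lin_comp k C n n l x (Psi k C n) | x. x \<in> carrier (free_module k (C n l))})"

end

theory Submission
  imports Defs
begin

text \<open>
  Call \<open>h : [n] \<rightarrow> [l]\<close> nondegenerate if \<open>h i \<noteq> h (i + 1)\<close> for \<open>1 \<le> i < n\<close>. In any of the four categories,
  right multiplication by \<open>\<Psi>\<^sub>n\<close> preserves the coefficients of \<open>x\<close> at nondegenerate maps and kills \<open>x\<close> if
  all these coefficients vanish; so \<open>x \<Psi>\<^sub>n\<close> encodes precisely the nondegenerate part of \<open>x\<close>. In \<open>OA\<close> and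
  \<open>BA\<close> the nondegenerate maps are the injective ones, which makes \<open>\<Delta>\<^sub>n\<close> isomorphic to \<open>kC\<Psi>\<^sub>n\<close> and a
  retract of \<open>P\<^sub>n\<close>. In \<open>CA\<close> and \<open>SA\<close> there are further nondegenerate maps, the composites \<open>g q\<close> of the
  injective maps \<open>g\<close> on \<open>[n - 1]\<close> with the surjection \<open>q : [n] \<rightarrow> [n - 1]\<close> that identifies \<open>n\<close> with \<open>1\<close>;
  hence \<open>x \<mapsto> x q \<Psi>\<^sub>n\<close> induces an isomorphism from \<open>\<Delta>\<^sub>n\<^sub>-\<^sub>1\<close> onto the kernel of \<open>kC\<Psi>\<^sub>n \<rightarrow> \<Delta>\<^sub>n\<close>.
\<close>

text \<open>A composite \<open>g d_i s_i\<close> takes equal values at \<open>i\<close> and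
  \<open>i + 1\<close>, so each factor \<open>1 - d_i s_i\<close> can alter coefficients at
  degenerate maps only. This is why elements are handled as coefficient functions: the product
  defining \<open>Psi\<close> is never expanded, and only the effect of one more factor on a single
  coefficient is computed. All of this takes place over an arbitrary category of maps containing
  \<open>OA\<close>; the four categories then differ only in their lists of nondegenerate maps. The
  obstacle is to find that list for \<open>CA\<close> and \<open>SA\<close>. The form rotation,
  monotone map, rotation is not visibly closed under composition and hides which values a map may
  repeat. Lifts to the integers settle both points. Lifts compose, and over one period a lift
  advances by exactly \<open>n\<close> (up to sign). Two arguments with equal values therefore force
  the lift to be constant on one of the two arcs between them, and a nondegenerate map allows this
  only on the arc from the last argument across the seam to the first.\<close>

declare One_nat_def [simp del]

section \<open>Linear maps and quotient modules\<close>

lemma submodule_abelian_subgroup: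
  assumes "module k M" "submodule H k M"
  shows "abelian_subgroup H M"
proof -
  interpret module k M by fact
  interpret submodule H k M by fact
  show ?thesis
    by (intro abelian_subgroupI3 additive_subgroupI subgroup_axioms abelian_group_axioms)
qed

lemma coset_eq_iff:
  assumes "module k M" "submodule H k M" "x \<in> carrier M" "y \<in> carrier M"
  shows "H +>\<^bsub>M\<^esub> x = H +>\<^bsub>M\<^esub> y \<longleftrightarrow> x \<ominus>\<^bsub>M\<^esub> y \<in> H"
proof -
  interpret abelian_subgroup H M by (rule submodule_abelian_subgroup[OF assms(1,2)])
  have "H +>\<^bsub>M\<^esub> x = H +>\<^bsub>M\<^esub> y \<longleftrightarrow> x \<in> H +>\<^bsub>M\<^esub> y"
    using a_repr_independence' a_repr_independenceD assms by metis
  then show ?thesis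
    using a_rcos_module[of y x] assms by (simp add: a_minus_def)
qed

lemma submodule_mem_iff_coset:
  assumes "module k M" "submodule H k M" "x \<in> carrier M"
  shows "x \<in> H \<longleftrightarrow> H +>\<^bsub>M\<^esub> x = H"
proof -
  interpret abelian_subgroup H M by (rule submodule_abelian_subgroup[OF assms(1,2)])
  show ?thesis using a_coset_join1 a_rcos_const a_subgroup assms(3) by auto
qed

text \<open>The module axioms are equations or, for negatives, can be met by the image of a
  negative, so they pass along a surjection that respects the operations. The hypothesis on zero is
  separate because nothing is known yet about \<open>\<zero>\<close> in \<open>Q\<close>; quotient
  modules are obtained this way.\<close>

lemma module_image:
  assumes "module k M" and im: "p ` carrier M = carrier Q"
    and add: "\<And>x y. x \<in> carrier M \<Longrightarrow> y \<in> carrier M \<Longrightarrow> p (x \<oplus>\<^bsub>M\<^esub> y) = p x \<oplus>\<^bsub>Q\<^esub> p y"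
    and smult: "\<And>a x. a \<in> carrier k \<Longrightarrow> x \<in> carrier M \<Longrightarrow> p (a \<odot>\<^bsub>M\<^esub> x) = a \<odot>\<^bsub>Q\<^esub> p x"
    and zero: "p \<zero>\<^bsub>M\<^esub> = \<zero>\<^bsub>Q\<^esub>"
  shows "module k Q"
proof -
  interpret module k M by fact
  have ex: "\<exists>x\<in>carrier M. X = p x" if "X \<in> carrier Q" for X
    using that im by blast
  have cl: "p x \<in> carrier Q" if "x \<in> carrier M" for x using that im by blast
  show ?thesis
  proof (rule moduleI)
    show "cring k" by (rule R.is_cring)
    show "abelian_group Q"
    proof (rule abelian_groupI)
      show "\<zero>\<^bsub>Q\<^esub> \<in> carrier Q" using cl[of "\<zero>\<^bsub>M\<^esub>"] zero by simp
    next
      fix X Y assume "X \<in> carrier Q" "Y \<in> carrier Q"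
      then show "X \<oplus>\<^bsub>Q\<^esub> Y \<in> carrier Q" by (metis ex cl add M.a_closed)
    next
      fix X Y Z assume "X \<in> carrier Q" "Y \<in> carrier Q" "Z \<in> carrier Q"
      then obtain x y z where "x \<in> carrier M" "y \<in> carrier M" "z \<in> carrier M"
        "X = p x" "Y = p y" "Z = p z" by (metis ex)
      then show "X \<oplus>\<^bsub>Q\<^esub> Y \<oplus>\<^bsub>Q\<^esub> Z = X \<oplus>\<^bsub>Q\<^esub> (Y \<oplus>\<^bsub>Q\<^esub> Z)"
        by (simp add: add[symmetric] M.a_assoc)
    next
      fix X Y assume "X \<in> carrier Q" "Y \<in> carrier Q"
      then show "X \<oplus>\<^bsub>Q\<^esub> Y = Y \<oplus>\<^bsub>Q\<^esub> X" by (metis ex add M.a_comm)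
    next
      fix X assume "X \<in> carrier Q"
      then show "\<zero>\<^bsub>Q\<^esub> \<oplus>\<^bsub>Q\<^esub> X = X" by (metis ex add zero M.l_zero M.zero_closed)
    next
      fix X assume "X \<in> carrier Q"
      then show "\<exists>y\<in>carrier Q. y \<oplus>\<^bsub>Q\<^esub> X = \<zero>\<^bsub>Q\<^esub>"
        by (metis ex add zero M.l_neg M.a_inv_closed cl)
    qed
  next
    fix a X assume "a \<in> carrier k" "X \<in> carrier Q"
    then show "a \<odot>\<^bsub>Q\<^esub> X \<in> carrier Q" by (metis ex cl smult smult_closed)
  next
    fix a b X assume "a \<in> carrier k" "b \<in> carrier k" "X \<in> carrier Q"
    then show "(a \<oplus>\<^bsub>k\<^esub> b) \<odot>\<^bsub>Q\<^esub> X = a \<odot>\<^bsub>Q\<^esub> X \<oplus>\<^bsub>Q\<^esub> b \<odot>\<^bsub>Q\<^esub> X"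
      using ex[of X] by (auto simp: smult[symmetric] add[symmetric] smult_l_distr)
  next
    fix a X Y assume "a \<in> carrier k" "X \<in> carrier Q" "Y \<in> carrier Q"
    then show "a \<odot>\<^bsub>Q\<^esub> (X \<oplus>\<^bsub>Q\<^esub> Y) = a \<odot>\<^bsub>Q\<^esub> X \<oplus>\<^bsub>Q\<^esub> a \<odot>\<^bsub>Q\<^esub> Y"
      using ex[of X] ex[of Y] by (auto simp: smult[symmetric] add[symmetric] smult_r_distr)
  next
    fix a b X assume "a \<in> carrier k" "b \<in> carrier k" "X \<in> carrier Q"
    then show "(a \<otimes>\<^bsub>k\<^esub> b) \<odot>\<^bsub>Q\<^esub> X = a \<odot>\<^bsub>Q\<^esub> (b \<odot>\<^bsub>Q\<^esub> X)"
      using ex[of X] by (auto simp: smult[symmetric] smult_assoc1)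
  next
    fix X assume "X \<in> carrier Q"
    then show "\<one>\<^bsub>k\<^esub> \<odot>\<^bsub>Q\<^esub> X = X" by (metis ex smult smult_one R.one_closed)
  qed
qed

lemma (in abelian_group) minus_eq_zero_iff:
  assumes "x \<in> carrier G" "y \<in> carrier G"
  shows "x \<ominus> y = \<zero> \<longleftrightarrow> x = y"
  using assms add.inv_solve_right[of \<zero> x y] by (auto simp: minus_eq r_neg)

lemma linear_mapsD:
  assumes "h \<in> linear_maps k M N"
  shows "x \<in> carrier M \<Longrightarrow> h x \<in> carrier N"
    and "x \<in> carrier M \<Longrightarrow> y \<in> carrier M \<Longrightarrow> h (x \<oplus>\<^bsub>M\<^esub> y) = h x \<oplus>\<^bsub>N\<^esub> h y"
    and "a \<in> carrier k \<Longrightarrow> x \<in> carrier M \<Longrightarrow> h (a \<odot>\<^bsub>M\<^esub> x) = a \<odot>\<^bsub>N\<^esub> h x"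
  using assms by (auto simp: linear_maps_def)

lemma linear_maps_comp:
  assumes "h \<in> linear_maps k L M" "g \<in> linear_maps k M N"
  shows "(\<lambda>x. g (h x)) \<in> linear_maps k L N"
  using assms by (auto simp: linear_maps_def Pi_iff)

lemma linear_maps_zero:
  assumes "module k M" "module k N" "h \<in> linear_maps k M N"
  shows "h \<zero>\<^bsub>M\<^esub> = \<zero>\<^bsub>N\<^esub>"
proof -
  interpret M: module k M by fact
  interpret N: module k N by fact
  have "h (\<zero>\<^bsub>k\<^esub> \<odot>\<^bsub>M\<^esub> \<zero>\<^bsub>M\<^esub>) = \<zero>\<^bsub>k\<^esub> \<odot>\<^bsub>N\<^esub> h \<zero>\<^bsub>M\<^esub>"
    by (intro linear_mapsD(3)[OF assms(3)]) auto
  then show ?thesis using linear_mapsD(1)[OF assms(3)] by simp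
qed

lemma linear_maps_minus:
  assumes "module k M" "module k N" "h \<in> linear_maps k M N" "x \<in> carrier M" "y \<in> carrier M"
  shows "h (x \<ominus>\<^bsub>M\<^esub> y) = h x \<ominus>\<^bsub>N\<^esub> h y"
proof -
  interpret M: module k M by fact
  interpret N: module k N by fact
  note lin = linear_mapsD[OF assms(3)]
  have "h (x \<ominus>\<^bsub>M\<^esub> y) \<oplus>\<^bsub>N\<^esub> h y = h ((x \<ominus>\<^bsub>M\<^esub> y) \<oplus>\<^bsub>M\<^esub> y)"
    using assms by (simp add: lin)
  also have "(x \<ominus>\<^bsub>M\<^esub> y) \<oplus>\<^bsub>M\<^esub> y = x"
    using assms by (simp add: a_minus_def M.add.m_assoc M.l_neg)
  finally show ?thesis
    using assms lin(1) by (simp add: a_minus_def N.add.inv_solve_right)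
qed

lemma linear_maps_finsum:
  assumes "module k M" "module k N" "h \<in> linear_maps k M N" "finite A" "f \<in> A \<rightarrow> carrier M"
  shows "h (\<Oplus>\<^bsub>M\<^esub>i\<in>A. f i) = (\<Oplus>\<^bsub>N\<^esub>i\<in>A. h (f i))"
proof -
  interpret M: module k M by fact
  interpret N: module k N by fact
  note lin = linear_mapsD[OF assms(3)]
  show ?thesis
    using assms(4,5)
  proof (induction A)
    case empty
    then show ?case using linear_maps_zero[OF assms(1-3)] by simp
  next
    case (insert i A)
    then have "(\<lambda>i. h (f i)) \<in> A \<rightarrow> carrier N" using lin(1) by auto
    with insert show ?case using lin by (simp add: Pi_iff)
  qed
qed

lemma submodule_linear_image:
  assumes "module k M" "module k N" "h \<in> linear_maps k M N"
  shows "submodule (h ` carrier M) k N"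
proof -
  interpret M: module k M by fact
  interpret N: module k N by fact
  note lin = linear_mapsD[OF assms(3)]
  have zero: "h \<zero>\<^bsub>M\<^esub> = \<zero>\<^bsub>N\<^esub>" by (rule linear_maps_zero[OF assms])
  show ?thesis
  proof (rule N.submoduleI)
    show "\<zero>\<^bsub>N\<^esub> \<in> h ` carrier M" using zero by (metis M.zero_closed imageI)
  next
    fix y assume "y \<in> h ` carrier M"
    then obtain x where x: "x \<in> carrier M" "y = h x" by blast
    have "h (\<ominus>\<^bsub>M\<^esub> x) = \<ominus>\<^bsub>N\<^esub> y"
      using linear_maps_minus[OF assms M.zero_closed x(1)] x zero lin(1) by (simp add: a_minus_def)
    then show "\<ominus>\<^bsub>N\<^esub> y \<in> h ` carrier M" using x(1) by (metis M.a_inv_closed imageI)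
  next
    fix y y' assume "y \<in> h ` carrier M" "y' \<in> h ` carrier M"
    then show "y \<oplus>\<^bsub>N\<^esub> y' \<in> h ` carrier M" using lin(2) by (auto simp: lin(2)[symmetric])
  next
    fix a y assume "a \<in> carrier k" "y \<in> h ` carrier M"
    then show "a \<odot>\<^bsub>N\<^esub> y \<in> h ` carrier M" by (auto simp: lin(3)[symmetric])
  qed (use lin(1) in auto)
qed

text \<open>The quotient operations are defined as unions over all representatives. Two
  representatives differ by an element of \<open>H\<close>, which \<open>h\<close> sends into
  \<open>K\<close>, so all members of the union are the same coset. With \<open>h\<close> a scalar
  multiplication this treats \<open>smult\<close>, with \<open>h\<close> the action of a morphism it
  treats \<open>act\<close>.\<close>

lemma UN_coset_linear:
  assumes "module k M" "submodule H k M" "module k N" "submodule K k N"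
    and h: "h \<in> linear_maps k M N" "h ` H \<subseteq> K" and x: "x \<in> carrier M"
  shows "(\<Union>y\<in>H +>\<^bsub>M\<^esub> x. K +>\<^bsub>N\<^esub> h y) = K +>\<^bsub>N\<^esub> h x"
proof -
  interpret H: abelian_subgroup H M by (rule submodule_abelian_subgroup[OF assms(1,2)])
  interpret K: abelian_subgroup K N by (rule submodule_abelian_subgroup[OF assms(3,4)])
  have "K +>\<^bsub>N\<^esub> h y = K +>\<^bsub>N\<^esub> h x" if "y \<in> H +>\<^bsub>M\<^esub> x" for y
  proof -
    have y: "y \<in> carrier M" using that x H.a_elemrcos_carrier by blast
    have "y \<ominus>\<^bsub>M\<^esub> x \<in> H"
      using that x H.a_rcos_module_imp by (simp add: a_minus_def)
    then have "h y \<ominus>\<^bsub>N\<^esub> h x \<in> K"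
      using h(2) linear_maps_minus[OF assms(1,3) h(1) y x] by auto
    then show ?thesis
      using coset_eq_iff[OF assms(3,4)] linear_mapsD(1)[OF h(1)] x y by simp
  qed
  moreover have "x \<in> H +>\<^bsub>M\<^esub> x" using x by (rule H.a_rcos_self)
  ultimately show ?thesis by blast
qed

lemma smult_linear:
  assumes "module k M" "a \<in> carrier k"
  shows "(\<lambda>x. a \<odot>\<^bsub>M\<^esub> x) \<in> linear_maps k M M"
proof -
  interpret module k M by fact
  have "a \<odot>\<^bsub>M\<^esub> (b \<odot>\<^bsub>M\<^esub> x) = b \<odot>\<^bsub>M\<^esub> (a \<odot>\<^bsub>M\<^esub> x)"
    if "b \<in> carrier k" "x \<in> carrier M" for b x
    using that assms(2) by (simp add: smult_assoc1[symmetric] R.m_comm)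
  then show ?thesis using assms(2) by (auto simp: linear_maps_def smult_r_distr)
qed

section \<open>Quotients of modules over \<open>k\<close>\<close>

lemma carrier_quot_module: "carrier (quot_module M H) = (\<lambda>x. H +>\<^bsub>M\<^esub> x) ` carrier M"
  by (auto simp: quot_module_def A_RCOSETS_def')

context
  fixes k :: "('r, 'm) ring_scheme" and M :: "('r, 'a) module" and H
  assumes M: "module k M" and H: "submodule H k M"
begin

lemma coset_linear: "(\<lambda>x. H +>\<^bsub>M\<^esub> x) \<in> linear_maps k M (quot_module M H)"
proof -
  interpret abelian_subgroup H M by (rule submodule_abelian_subgroup[OF M H])
  have "(\<Union>y\<in>H +>\<^bsub>M\<^esub> x. H +>\<^bsub>M\<^esub> (a \<odot>\<^bsub>M\<^esub> y)) = H +>\<^bsub>M\<^esub> (a \<odot>\<^bsub>M\<^esub> x)"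
    if "a \<in> carrier k" "x \<in> carrier M" for a x
    by (rule UN_coset_linear[OF M H M H smult_linear[OF M that(1)] _ that(2)])
      (use submodule.smult_closed[OF H] that in auto)
  then show ?thesis
    by (auto simp: linear_maps_def carrier_quot_module)
      (simp_all add: quot_module_def a_rcos_sum)
qed

lemma module_quot_module: "module k (quot_module M H)"
proof -
  interpret abelian_subgroup H M by (rule submodule_abelian_subgroup[OF M H])
  show ?thesis
  proof (rule module_image[OF M])
    show "(\<lambda>x. H +>\<^bsub>M\<^esub> x) ` carrier M = carrier (quot_module M H)"
      by (simp add: carrier_quot_module)
    show "H +>\<^bsub>M\<^esub> \<zero>\<^bsub>M\<^esub> = \<zero>\<^bsub>quot_module M H\<^esub>"
      by (simp add: quot_module_def a_subset)
  qed (use linear_mapsD[OF coset_linear] in auto)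
qed

end

section \<open>Modules over a category\<close>

lemma cat_moduleD:
  assumes "is_cat_module k C M"
  shows "n \<ge> 1 \<Longrightarrow> module k (obj M n)"
    and "m \<ge> 1 \<Longrightarrow> n \<ge> 1 \<Longrightarrow> f \<in> C m n \<Longrightarrow> act M m n f \<in> linear_maps k (obj M m) (obj M n)"
    and "n \<ge> 1 \<Longrightarrow> x \<in> carrier (obj M n) \<Longrightarrow> act M n n (\<lambda>i\<in>{1..n}. i) x = x"
    and "l \<ge> 1 \<Longrightarrow> m \<ge> 1 \<Longrightarrow> n \<ge> 1 \<Longrightarrow> f \<in> C l m \<Longrightarrow> g \<in> C m n \<Longrightarrow> x \<in> carrier (obj M l) \<Longrightarrow>
      act M l n (compose {1..l} g f) x = act M m n g (act M l m f x)"
  using assms by (simp_all add: is_cat_module_def)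

lemma cat_module_homD:
  assumes "\<eta> \<in> cat_module_hom k C M N"
  shows "n \<ge> 1 \<Longrightarrow> \<eta> n \<in> linear_maps k (obj M n) (obj N n)"
    and "m \<ge> 1 \<Longrightarrow> n \<ge> 1 \<Longrightarrow> f \<in> C m n \<Longrightarrow> x \<in> carrier (obj M m) \<Longrightarrow>
      \<eta> n (act M m n f x) = act N m n f (\<eta> m x)"
  using assms by (simp_all add: cat_module_hom_def)

lemma cat_module_hom_comp:
  assumes "\<eta> \<in> cat_module_hom k C L M" "\<theta> \<in> cat_module_hom k C M N"
  shows "(\<lambda>n x. \<theta> n (\<eta> n x)) \<in> cat_module_hom k C L N"
  unfolding cat_module_hom_def
proof safe
  fix n :: nat assume n: "n \<ge> 1"
  show "(\<lambda>x. \<theta> n (\<eta> n x)) \<in> linear_maps k (obj L n) (obj N n)"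
    by (rule linear_maps_comp[OF cat_module_homD(1)[OF assms(1) n] cat_module_homD(1)[OF assms(2) n]])
next
  fix m n :: nat and f x assume "m \<ge> 1" "n \<ge> 1" "f \<in> C m n" "x \<in> carrier (obj L m)"
  then show "\<theta> n (\<eta> n (act L m n f x)) = act N m n f (\<theta> m (\<eta> m x))"
    using cat_module_homD[OF assms(1)] cat_module_homD[OF assms(2)] linear_mapsD(1) by metis
qed

section \<open>Submodules, quotients and images of modules over a category\<close>

text \<open>\<open>sub_cat_module\<close> and \<open>quot_cat_module\<close> accept any family of
  sets; this is the condition under which they yield modules.\<close>

definition cat_submodule ::
  "('r, 'm) ring_scheme \<Rightarrow> homsets \<Rightarrow> ('r, 'a) cat_module \<Rightarrow> (nat \<Rightarrow> 'a set) \<Rightarrow> bool" where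
  "cat_submodule k C M S \<longleftrightarrow>
     (\<forall>n\<ge>1. submodule (S n) k (obj M n)) \<and>
     (\<forall>m\<ge>1. \<forall>n\<ge>1. \<forall>f\<in>C m n. act M m n f ` S m \<subseteq> S n)"

lemma cat_submoduleD:
  assumes "cat_submodule k C M S"
  shows "n \<ge> 1 \<Longrightarrow> submodule (S n) k (obj M n)"
    and "n \<ge> 1 \<Longrightarrow> S n \<subseteq> carrier (obj M n)"
    and "m \<ge> 1 \<Longrightarrow> n \<ge> 1 \<Longrightarrow> f \<in> C m n \<Longrightarrow> act M m n f ` S m \<subseteq> S n"
  using assms subgroup.subset[OF submodule.axioms(1)] by (fastforce simp: cat_submodule_def)+

text \<open>Morphisms are functions, so associativity is inherited from composition of functions;
  see \<open>comp_assoc\<close>.\<close>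

definition category :: "homsets \<Rightarrow> bool" where
  "category C \<longleftrightarrow>
     (\<forall>n\<ge>1. (\<lambda>i\<in>{1..n}. i) \<in> C n n) \<and>
     (\<forall>l\<ge>1. \<forall>m\<ge>1. \<forall>n\<ge>1. \<forall>f\<in>C l m. \<forall>g\<in>C m n. compose {1..l} g f \<in> C l n)"

context
  fixes k :: "('r, 'm) ring_scheme" and C :: homsets and M :: "('r, 'a) cat_module"
    and S :: "nat \<Rightarrow> 'a set"
  assumes M: "is_cat_module k C M" and S: "cat_submodule k C M S"
begin

lemma is_cat_module_sub: "is_cat_module k C (sub_cat_module M S)"
  unfolding is_cat_module_def sub_cat_module_def cat_module.simps
proof (intro conjI allI impI ballI)
  fix n :: nat assume "n \<ge> 1"
  then show "module k (obj M n\<lparr>carrier := S n\<rparr>)"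
    using submodule.submodule_is_module cat_submoduleD(1)[OF S] cat_moduleD(1)[OF M] by blast
next
  fix m n :: nat and f assume "m \<ge> 1" "n \<ge> 1" "f \<in> C m n"
  then show "act M m n f \<in> linear_maps k (obj M m\<lparr>carrier := S m\<rparr>) (obj M n\<lparr>carrier := S n\<rparr>)"
    using linear_mapsD[OF cat_moduleD(2)[OF M, of m n f]] cat_submoduleD(2)[OF S, of m]
      cat_submoduleD(3)[OF S, of m n f]
    by (auto simp: linear_maps_def subset_iff)
next
  fix n :: nat and x assume "n \<ge> 1" "x \<in> carrier (obj M n\<lparr>carrier := S n\<rparr>)"
  then show "act M n n (\<lambda>i\<in>{1..n}. i) x = x"
    using cat_moduleD(3)[OF M, of n x] cat_submoduleD(2)[OF S, of n] by auto
next
  fix l m n :: nat and f g x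
  assume "l \<ge> 1" "m \<ge> 1" "n \<ge> 1" "f \<in> C l m" "g \<in> C m n" "x \<in> carrier (obj M l\<lparr>carrier := S l\<rparr>)"
  then show "act M l n (compose {1..l} g f) x = act M m n g (act M l m f x)"
    using cat_moduleD(4)[OF M, of l m n f g x] cat_submoduleD(2)[OF S, of l] by auto
qed

lemma sub_inclusion_hom: "(\<lambda>n x. x) \<in> cat_module_hom k C (sub_cat_module M S) M"
  using cat_submoduleD(2)[OF S]
  by (auto simp: cat_module_hom_def sub_cat_module_def linear_maps_def)

lemma hom_into_sub:
  assumes "\<eta> \<in> cat_module_hom k C L M" "\<And>n. n \<ge> 1 \<Longrightarrow> \<eta> n ` carrier (obj L n) \<subseteq> S n"
  shows "\<eta> \<in> cat_module_hom k C L (sub_cat_module M S)"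
  using assms by (auto simp: cat_module_hom_def sub_cat_module_def linear_maps_def)

lemma act_quot:
  assumes "m \<ge> 1" "n \<ge> 1" "f \<in> C m n" "x \<in> carrier (obj M m)"
  shows "act (quot_cat_module M S) m n f (S m +>\<^bsub>obj M m\<^esub> x) = S n +>\<^bsub>obj M n\<^esub> act M m n f x"
  using UN_coset_linear[of k "obj M m" "S m" "obj M n" "S n" "act M m n f" x] assms
    cat_moduleD(1,2)[OF M] cat_submoduleD(1,3)[OF S]
  by (simp add: quot_cat_module_def)

lemma carrier_quot: "carrier (obj (quot_cat_module M S) n) = (\<lambda>x. S n +>\<^bsub>obj M n\<^esub> x) ` carrier (obj M n)"
  by (simp add: quot_cat_module_def carrier_quot_module)

lemma coset_linear_quot:
  assumes "n \<ge> 1"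
  shows "(\<lambda>x. S n +>\<^bsub>obj M n\<^esub> x) \<in> linear_maps k (obj M n) (obj (quot_cat_module M S) n)"
  using coset_linear[OF cat_moduleD(1)[OF M assms] cat_submoduleD(1)[OF S assms]]
  by (simp add: quot_cat_module_def)

lemma coset_hom: "(\<lambda>n x. S n +>\<^bsub>obj M n\<^esub> x) \<in> cat_module_hom k C M (quot_cat_module M S)"
  by (simp add: cat_module_hom_def coset_linear_quot act_quot)

text \<open>By \<open>act_quot\<close> every law reduces to the same law for representatives.
  \<open>category\<close> ensures that identities and composites are morphisms of \<open>C\<close>,
  so that \<open>act_quot\<close> applies to them.\<close>

lemma is_cat_module_quot:
  assumes C: "category C"
  shows "is_cat_module k C (quot_cat_module M S)"
  unfolding is_cat_module_def
proof (intro conjI allI impI ballI)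
  fix n :: nat assume "n \<ge> 1"
  then show "module k (obj (quot_cat_module M S) n)"
    using module_quot_module[OF cat_moduleD(1)[OF M] cat_submoduleD(1)[OF S]]
    by (simp add: quot_cat_module_def)
next
  fix m n :: nat and f assume mn: "m \<ge> 1" "n \<ge> 1" and f: "f \<in> C m n"
  note [simp] = act_quot[OF mn f] linear_mapsD[OF cat_moduleD(2)[OF M mn f]]
    linear_mapsD(2,3)[OF coset_linear_quot, symmetric]
  interpret module k "obj M m" by (rule cat_moduleD(1)[OF M mn(1)])
  show "act (quot_cat_module M S) m n f \<in>
      linear_maps k (obj (quot_cat_module M S) m) (obj (quot_cat_module M S) n)"
    using mn by (auto simp: linear_maps_def carrier_quot)
next
  fix n :: nat and X assume "n \<ge> 1" "X \<in> carrier (obj (quot_cat_module M S) n)"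
  moreover have "(\<lambda>i\<in>{1..n}. i) \<in> C n n" using C \<open>n \<ge> 1\<close> unfolding category_def by blast
  ultimately show "act (quot_cat_module M S) n n (\<lambda>i\<in>{1..n}. i) X = X"
    using cat_moduleD(3)[OF M] by (auto simp only: carrier_quot act_quot)
next
  fix l m n :: nat and f g X
  assume *: "l \<ge> 1" "m \<ge> 1" "n \<ge> 1" "f \<in> C l m" "g \<in> C m n"
    "X \<in> carrier (obj (quot_cat_module M S) l)"
  moreover have "compose {1..l} g f \<in> C l n" using C * unfolding category_def by blast
  ultimately show "act (quot_cat_module M S) l n (compose {1..l} g f) X =
      act (quot_cat_module M S) m n g (act (quot_cat_module M S) l m f X)"
    using linear_mapsD(1)[OF cat_moduleD(2)[OF M, of l m f]]
    by (auto simp: carrier_quot act_quot cat_moduleD(4)[OF M])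
qed

lemma hom_from_quot:
  assumes N: "is_cat_module k C N" and \<eta>: "\<eta> \<in> cat_module_hom k C M N"
    and ker: "\<And>n x. n \<ge> 1 \<Longrightarrow> x \<in> S n \<Longrightarrow> \<eta> n x = \<zero>\<^bsub>obj N n\<^esub>"
  obtains \<theta> where "\<theta> \<in> cat_module_hom k C (quot_cat_module M S) N"
    "\<And>n x. n \<ge> 1 \<Longrightarrow> x \<in> carrier (obj M n) \<Longrightarrow> \<theta> n (S n +>\<^bsub>obj M n\<^esub> x) = \<eta> n x"
proof
  \<comment> \<open>An arbitrary representative will do: any other one differs from it by an element
    of \<open>S n\<close>, which \<eta> kills.\<close>
  let ?\<theta> = "\<lambda>n X. \<eta> n (SOME x. x \<in> X)"
  show \<theta>: "?\<theta> n (S n +>\<^bsub>obj M n\<^esub> x) = \<eta> n x" if n: "n \<ge> 1" and x: "x \<in> carrier (obj M n)" for n x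
  proof -
    interpret S: abelian_subgroup "S n" "obj M n"
      by (rule submodule_abelian_subgroup[OF cat_moduleD(1)[OF M n] cat_submoduleD(1)[OF S n]])
    interpret N: module k "obj N n" by (rule cat_moduleD(1)[OF N n])
    define y where "y = (SOME x'. x' \<in> S n +>\<^bsub>obj M n\<^esub> x)"
    have y: "y \<in> S n +>\<^bsub>obj M n\<^esub> x"
      unfolding y_def by (rule someI[of _ x]) (rule S.a_rcos_self[OF x])
    have yM: "y \<in> carrier (obj M n)" using y x S.a_elemrcos_carrier by blast
    have "y \<ominus>\<^bsub>obj M n\<^esub> x \<in> S n"
      using S.a_rcos_module_imp[OF x y] by (simp add: a_minus_def)
    then have "\<eta> n y \<ominus>\<^bsub>obj N n\<^esub> \<eta> n x = \<zero>\<^bsub>obj N n\<^esub>"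
      using ker[OF n] linear_maps_minus[OF cat_moduleD(1)[OF M n] cat_moduleD(1)[OF N n]
          cat_module_homD(1)[OF \<eta> n] yM x] by simp
    then show ?thesis
      using linear_mapsD(1)[OF cat_module_homD(1)[OF \<eta> n]] x yM
      unfolding y_def[symmetric] by (simp add: N.minus_eq_zero_iff)
  qed
  show "?\<theta> \<in> cat_module_hom k C (quot_cat_module M S) N"
    unfolding cat_module_hom_def
  proof (intro CollectI conjI allI impI ballI)
    fix n :: nat assume n: "n \<ge> 1"
    interpret M: module k "obj M n" by (rule cat_moduleD(1)[OF M n])
    note [simp] = linear_mapsD(2,3)[OF coset_linear_quot[OF n], symmetric]
      linear_mapsD[OF cat_module_homD(1)[OF \<eta> n]]
    show "?\<theta> n \<in> linear_maps k (obj (quot_cat_module M S) n) (obj N n)"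
      using \<theta>[OF n] by (auto simp: linear_maps_def carrier_quot)
  next
    fix m n :: nat and f X
    assume *: "m \<ge> 1" "n \<ge> 1" "f \<in> C m n" "X \<in> carrier (obj (quot_cat_module M S) m)"
    then show "?\<theta> n (act (quot_cat_module M S) m n f X) = act N m n f (?\<theta> m X)"
      using cat_module_homD(2)[OF \<eta>] linear_mapsD(1)[OF cat_moduleD(2)[OF M *(1-3)]]
      by (auto simp: carrier_quot act_quot \<theta>)
  qed
qed

end

text \<open>The homomorphism theorem. Knowing the kernel exactly, not just that it contains
  \<open>S n\<close>, makes the induced map injective. Both maps from standard modules into
  \<open>Psi_module\<close> arise from it.\<close>

lemma injective_hom_from_quot:
  assumes M: "is_cat_module k C M" and S: "cat_submodule k C M S"
    and N: "is_cat_module k C N" and \<eta>: "\<eta> \<in> cat_module_hom k C M N"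
    and ker: "\<And>n x. n \<ge> 1 \<Longrightarrow> x \<in> carrier (obj M n) \<Longrightarrow> \<eta> n x = \<zero>\<^bsub>obj N n\<^esub> \<longleftrightarrow> x \<in> S n"
  obtains \<theta> where "\<theta> \<in> cat_module_hom k C (quot_cat_module M S) N"
    "\<And>n x. n \<ge> 1 \<Longrightarrow> x \<in> carrier (obj M n) \<Longrightarrow> \<theta> n (S n +>\<^bsub>obj M n\<^esub> x) = \<eta> n x"
    "\<And>n. n \<ge> 1 \<Longrightarrow> inj_on (\<theta> n) (carrier (obj (quot_cat_module M S) n))"
    "\<And>n. n \<ge> 1 \<Longrightarrow> \<theta> n ` carrier (obj (quot_cat_module M S) n) = \<eta> n ` carrier (obj M n)"
proof -
  have "\<eta> n x = \<zero>\<^bsub>obj N n\<^esub>" if "n \<ge> 1" "x \<in> S n" for n x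
    using that ker cat_submoduleD(2)[OF S] by blast
  then obtain \<theta> where hom: "\<theta> \<in> cat_module_hom k C (quot_cat_module M S) N"
    and \<theta>: "\<And>n x. n \<ge> 1 \<Longrightarrow> x \<in> carrier (obj M n) \<Longrightarrow> \<theta> n (S n +>\<^bsub>obj M n\<^esub> x) = \<eta> n x"
    using hom_from_quot[OF M S N \<eta>] by metis
  have "inj_on (\<theta> n) (carrier (obj (quot_cat_module M S) n))" if n: "n \<ge> 1" for n
  proof (rule inj_onI)
    fix X Y assume "X \<in> carrier (obj (quot_cat_module M S) n)"
      "Y \<in> carrier (obj (quot_cat_module M S) n)" and eq: "\<theta> n X = \<theta> n Y"
    then obtain x y where xy: "x \<in> carrier (obj M n)" "y \<in> carrier (obj M n)"
      and XY: "X = S n +>\<^bsub>obj M n\<^esub> x" "Y = S n +>\<^bsub>obj M n\<^esub> y"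
      by (auto simp: carrier_quot[OF M S])
    interpret M: module k "obj M n" by (rule cat_moduleD(1)[OF M n])
    interpret N: module k "obj N n" by (rule cat_moduleD(1)[OF N n])
    have "\<eta> n (x \<ominus>\<^bsub>obj M n\<^esub> y) = \<zero>\<^bsub>obj N n\<^esub>"
      using linear_maps_minus[OF M.module_axioms N.module_axioms cat_module_homD(1)[OF \<eta> n] xy]
        eq xy XY \<theta>[OF n] linear_mapsD(1)[OF cat_module_homD(1)[OF \<eta> n]] by (simp add: N.minus_eq_zero_iff)
    then have "x \<ominus>\<^bsub>obj M n\<^esub> y \<in> S n" using ker[OF n] xy by simp
    then show "X = Y"
      using coset_eq_iff[OF M.module_axioms cat_submoduleD(1)[OF S n] xy] XY by simp
  qed
  moreover have "\<theta> n ` carrier (obj (quot_cat_module M S) n) = \<eta> n ` carrier (obj M n)" if "n \<ge> 1" for n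
    using that \<theta> by (simp add: carrier_quot[OF M S] image_image)
  ultimately show thesis using that hom \<theta> by blast
qed

lemma cat_submodule_image:
  assumes M: "is_cat_module k C M" and N: "is_cat_module k C N" and \<eta>: "\<eta> \<in> cat_module_hom k C M N"
  shows "cat_submodule k C N (\<lambda>n. \<eta> n ` carrier (obj M n))"
  unfolding cat_submodule_def
proof (intro conjI allI impI ballI)
  fix n :: nat assume n: "n \<ge> 1"
  show "submodule (\<eta> n ` carrier (obj M n)) k (obj N n)"
    by (rule submodule_linear_image[OF cat_moduleD(1)[OF M n] cat_moduleD(1)[OF N n] cat_module_homD(1)[OF \<eta> n]])
next
  fix m n :: nat and f assume *: "m \<ge> 1" "n \<ge> 1" "f \<in> C m n"
  show "act N m n f ` \<eta> m ` carrier (obj M m) \<subseteq> \<eta> n ` carrier (obj M n)"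
    using linear_mapsD(1)[OF cat_moduleD(2)[OF M *]] cat_module_homD(2)[OF \<eta> *]
    by (auto simp: image_iff) metis
qed

text \<open>Lift the composite of \<phi> and \<pi> over \<open>P\<close>, then precompose with
  \<sigma>; as \<pi> undoes \<sigma>, this is a lift of \<phi>.\<close>

lemma projective_retract:
  fixes k :: "('r, 'm) ring_scheme"
  assumes P: "projective TYPE('b) TYPE('c) k C P" and Q: "is_cat_module k C Q"
    and \<sigma>: "\<sigma> \<in> cat_module_hom k C Q P" and \<pi>: "\<pi> \<in> cat_module_hom k C P Q"
    and \<pi>\<sigma>: "\<And>n x. n \<ge> 1 \<Longrightarrow> x \<in> carrier (obj Q n) \<Longrightarrow> \<pi> n (\<sigma> n x) = x"
  shows "projective TYPE('b) TYPE('c) k C Q"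
  unfolding projective_def
proof (intro conjI Q allI impI ballI)
  fix M :: "('r, 'b) cat_module" and N :: "('r, 'c) cat_module" and \<eta> \<phi>
  assume MN: "is_cat_module k C M" "is_cat_module k C N" "\<eta> \<in> cat_module_hom k C M N"
    and \<phi>: "\<phi> \<in> cat_module_hom k C Q N"
    and surj: "\<forall>n\<ge>1. \<eta> n ` carrier (obj M n) = carrier (obj N n)"
  have "\<exists>\<psi>\<in>cat_module_hom k C P M. \<forall>n\<ge>1. \<forall>x\<in>carrier (obj P n). \<eta> n (\<psi> n x) = \<phi> n (\<pi> n x)"
    using P[unfolded projective_def, THEN conjunct2, rule_format, OF MN cat_module_hom_comp[OF \<pi> \<phi>]]
      surj by blast
  then obtain \<psi> where \<psi>: "\<psi> \<in> cat_module_hom k C P M"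
    "\<And>n x. n \<ge> 1 \<Longrightarrow> x \<in> carrier (obj P n) \<Longrightarrow> \<eta> n (\<psi> n x) = \<phi> n (\<pi> n x)"
    by blast
  show "\<exists>\<psi>\<in>cat_module_hom k C Q M. \<forall>n\<ge>1. \<forall>x\<in>carrier (obj Q n). \<eta> n (\<psi> n x) = \<phi> n x"
    using cat_module_hom_comp[OF \<sigma> \<psi>(1)] \<psi>(2) \<pi>\<sigma> linear_mapsD(1)[OF cat_module_homD(1)[OF \<sigma>]]
    by (intro bexI[of _ "\<lambda>n x. \<psi> n (\<sigma> n x)"]) auto
qed

section \<open>Free modules\<close>

text \<open>Regroups a sum by the value of \<phi>. Associativity of \<open>lin_comp\<close> and
  naturality in \<open>yoneda\<close> both rest on it, with \<phi> given by composition.\<close>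

lemma (in abelian_monoid) finsum_fibers:
  assumes "finite S" "finite T" "\<phi> \<in> S \<rightarrow> T" "F \<in> S \<rightarrow> carrier G"
  shows "(\<Oplus>t\<in>T. \<Oplus>s\<in>{s \<in> S. \<phi> s = t}. F s) = (\<Oplus>s\<in>S. F s)"
proof -
  have "(\<Oplus>t\<in>T. \<Oplus>s\<in>{s \<in> S. \<phi> s = t}. F s) = (\<Oplus>s\<in>(\<Union>t\<in>T. {s \<in> S. \<phi> s = t}). F s)"
    using assms by (intro add.finprod_UN_disjoint[symmetric]) (auto simp: pairwise_def disjnt_def)
  also have "(\<Union>t\<in>T. {s \<in> S. \<phi> s = t}) = S" using assms(3) by auto
  finally show ?thesis .
qed

lemma free_module_simps:
  "carrier (free_module k S) = S \<rightarrow>\<^sub>E carrier k"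
  "\<zero>\<^bsub>free_module k S\<^esub> = (\<lambda>s\<in>S. \<zero>\<^bsub>k\<^esub>)"
  "x \<oplus>\<^bsub>free_module k S\<^esub> y = (\<lambda>s\<in>S. x s \<oplus>\<^bsub>k\<^esub> y s)"
  "a \<odot>\<^bsub>free_module k S\<^esub> x = (\<lambda>s\<in>S. a \<otimes>\<^bsub>k\<^esub> x s)"
  by (simp_all add: free_module_def)

lemma free_module_eqI:
  assumes "x \<in> carrier (free_module k S)" "y \<in> carrier (free_module k S)"
    "\<And>s. s \<in> S \<Longrightarrow> x s = y s"
  shows "x = y"
  using assms by (auto simp: free_module_simps intro: PiE_ext)

context cring
begin

lemma basis_closed [simp]: "basis R S s \<in> carrier (free_module R S)"
  by (auto simp: basis_def free_module_simps)

lemma free_module_eval [simp]: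
  "x \<in> carrier (free_module R S) \<Longrightarrow> s \<in> S \<Longrightarrow> x s \<in> carrier R"
  by (auto simp: free_module_simps)

lemma module_free_module: "module R (free_module R S)"
proof (rule moduleI)
  show "abelian_group (free_module R S)"
  proof (rule abelian_groupI)
    fix x assume x: "x \<in> carrier (free_module R S)"
    show "\<exists>y\<in>carrier (free_module R S). y \<oplus>\<^bsub>free_module R S\<^esub> x = \<zero>\<^bsub>free_module R S\<^esub>"
      using x by (intro bexI[of _ "\<lambda>s\<in>S. \<ominus> x s"])
        (auto simp: free_module_simps l_neg PiE_iff intro!: restrict_ext)
  qed (auto simp: free_module_simps a_ac PiE_iff extensional_def fun_eq_iff)
qed (auto simp: free_module_simps PiE_iff extensional_def fun_eq_iff l_distr r_distr m_assoc is_cring)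

lemma free_module_a_inv:
  assumes "y \<in> carrier (free_module R S)"
  shows "\<ominus>\<^bsub>free_module R S\<^esub> y = (\<lambda>s\<in>S. \<ominus> y s)"
proof -
  interpret F: module R "free_module R S" by (rule module_free_module)
  show ?thesis
    using assms by (intro F.minus_equality)
      (auto simp: free_module_simps l_neg PiE_iff intro!: restrict_ext)
qed

lemma free_module_minus:
  assumes "y \<in> carrier (free_module R S)" "s \<in> S"
  shows "(x \<ominus>\<^bsub>free_module R S\<^esub> y) s = x s \<ominus> y s"
  using assms by (simp add: a_minus_def free_module_a_inv) (simp add: free_module_simps)

lemma free_module_finsum:
  assumes "finite A" "F \<in> A \<rightarrow> carrier (free_module R S)" "s \<in> S"
  shows "(\<Oplus>\<^bsub>free_module R S\<^esub>i\<in>A. F i) s = (\<Oplus>i\<in>A. F i s)"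
proof -
  interpret F: module R "free_module R S" by (rule module_free_module)
  show ?thesis
    using assms(1,2)
  proof (induction A)
    case empty
    then show ?case using assms(3) by (simp add: free_module_simps)
  next
    case (insert a A)
    then have "F \<in> A \<rightarrow> carrier (free_module R S)" "F a \<in> carrier (free_module R S)"
      by auto
    moreover have "F i s \<in> carrier R" if "i \<in> insert a A" for i
      using that insert.prems assms(3) by (intro free_module_eval) auto
    then have "(\<lambda>i. F i s) \<in> A \<rightarrow> carrier R" "F a s \<in> carrier R" by auto
    ultimately show ?case using insert assms(3) by (simp add: free_module_simps(3))
  qed
qed

lemma finsum_eq_single:
  assumes "finite A" "a \<in> A" "x a \<in> carrier R" "\<And>b. b \<in> A \<Longrightarrow> b \<noteq> a \<Longrightarrow> x b = \<zero>"
  shows "(\<Oplus>b\<in>A. x b) = x a"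
proof -
  have "x b \<in> carrier R" if "b \<in> A" for b using assms that by (cases "b = a") auto
  then have "(\<Oplus>b\<in>{a}. x b) = (\<Oplus>b\<in>A. x b)"
    using assms by (intro add.finprod_mono_neutral_cong_left) auto
  then show ?thesis using assms(3) by simp
qed

lemma free_module_expansion:
  assumes "finite S" and x: "x \<in> carrier (free_module R S)"
  shows "(\<Oplus>\<^bsub>free_module R S\<^esub>s\<in>S. x s \<odot>\<^bsub>free_module R S\<^esub> basis R S s) = x"
proof -
  interpret F: module R "free_module R S" by (rule module_free_module)
  have F: "(\<lambda>s. x s \<odot>\<^bsub>free_module R S\<^esub> basis R S s) \<in> S \<rightarrow> carrier (free_module R S)"
    using x by auto
  show ?thesis
  proof (rule free_module_eqI[OF F.finsum_closed[OF F] x])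
    fix s assume s: "s \<in> S"
    have "(\<Oplus>t\<in>S. (x t \<odot>\<^bsub>free_module R S\<^esub> basis R S t) s) = (x s \<odot>\<^bsub>free_module R S\<^esub> basis R S s) s"
      using assms s by (intro finsum_eq_single) (auto simp: free_module_simps(4) basis_def)
    then show "(\<Oplus>\<^bsub>free_module R S\<^esub>s\<in>S. x s \<odot>\<^bsub>free_module R S\<^esub> basis R S s) s = x s"
      using s x by (simp add: free_module_finsum[OF assms(1) F]) (simp add: free_module_simps(4) basis_def)
  qed
qed

section \<open>The span of a set of basis elements\<close>

lemma supported_submodule:
  "submodule {x \<in> carrier (free_module R S). \<forall>s\<in>S - B. x s = \<zero>} R (free_module R S)" (is "submodule ?V _ _")
proof -
  interpret F: module R "free_module R S" by (rule module_free_module)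
  show ?thesis
  proof (rule F.submoduleI)
    fix x assume x: "x \<in> ?V"
    then show "\<ominus>\<^bsub>free_module R S\<^esub> x \<in> ?V"
      using F.a_inv_closed[of x] by (auto simp: free_module_a_inv)
  next
    fix x y assume "x \<in> ?V" "y \<in> ?V"
    then show "x \<oplus>\<^bsub>free_module R S\<^esub> y \<in> ?V"
      using F.a_closed[of x y] by (auto simp: free_module_simps)
  next
    fix a x assume "a \<in> carrier R" "x \<in> ?V"
    then show "a \<odot>\<^bsub>free_module R S\<^esub> x \<in> ?V"
      using F.smult_closed[of a x] by (auto simp: free_module_simps)
  qed (auto simp: free_module_simps)
qed

text \<open>Turns the hull defining \<open>noninjective_span\<close> into a vanishing condition on
  coefficients. For minimality, clear the coefficient at one \<open>b\<close> at a time: what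
  remains is covered by induction, and the removed part is a multiple of a generator.\<close>

lemma span_basis:
  assumes "finite B" "B \<subseteq> S"
  shows "(\<lambda>H. submodule H R (free_module R S)) hull (basis R S ` B) =
    {x \<in> carrier (free_module R S). \<forall>s\<in>S - B. x s = \<zero>}" (is "_ = ?V B")
proof (rule hull_unique)
  show "basis R S ` B \<subseteq> ?V B" by (auto simp: basis_def free_module_simps)
  show "submodule (?V B) R (free_module R S)" by (rule supported_submodule)
next
  interpret F: module R "free_module R S" by (rule module_free_module)
  fix H assume B: "basis R S ` B \<subseteq> H" and H: "submodule H R (free_module R S)"
  have "?V A \<subseteq> H" if "finite A" "A \<subseteq> B" for A
    using that
  proof (induction A)
    case empty
    have "x = \<zero>\<^bsub>free_module R S\<^esub>" if "x \<in> ?V {}" for x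
      using that by (intro free_module_eqI[of _ R S]) (auto simp: free_module_simps)
    then show ?case using subgroup.one_closed[OF submodule.axioms(1)[OF H]] by auto
  next
    case (insert b A)
    show ?case
    proof
      fix x assume x: "x \<in> ?V (insert b A)"
      let ?y = "\<lambda>s\<in>S. if s = b then \<zero> else x s"
      have b: "b \<in> S" using insert.prems assms by auto
      have "?y \<in> ?V A" using x by (auto simp: free_module_simps)
      then have "?y \<in> H" using insert by auto
      moreover have "x b \<odot>\<^bsub>free_module R S\<^esub> basis R S b \<in> H"
        using B insert.prems x b by (intro submodule.smult_closed[OF H]) auto
      moreover have "x = ?y \<oplus>\<^bsub>free_module R S\<^esub> (x b \<odot>\<^bsub>free_module R S\<^esub> basis R S b)"
        using x b by (intro free_module_eqI[of _ R S])
          (auto simp: free_module_simps basis_def PiE_iff)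
      ultimately show "x \<in> H" using F.submoduleE(5)[OF H] by metis
    qed
  qed
  then show "?V B \<subseteq> H" using assms(1) by blast
qed

end

section \<open>The linearised category\<close>

text \<open>The common ground of the four categories. \<open>hom_PiE\<close> makes the hom-sets
  finite, so that all sums make sense, and \<open>OA_subset\<close> provides the maps
  \<open>d_i s_i\<close> from which \<open>Psi\<close> is built.\<close>

locale linearised_category = cring k for k :: "('r, 'm) ring_scheme" (structure) +
  fixes C :: homsets
  assumes category: "category C"
    and hom_PiE: "C m n \<subseteq> {1..m} \<rightarrow>\<^sub>E {1..n}"
    and OA_subset: "OA m n \<subseteq> C m n"
begin

abbreviation kC :: "nat \<Rightarrow> nat \<Rightarrow> ((nat \<Rightarrow> nat) \<Rightarrow> 'r) set" where
  "kC m n \<equiv> carrier (free_module k (C m n))"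

abbreviation factorizations :: "nat \<Rightarrow> nat \<Rightarrow> nat \<Rightarrow> (nat \<Rightarrow> nat) \<Rightarrow> ((nat \<Rightarrow> nat) \<times> (nat \<Rightarrow> nat)) set" where
  "factorizations l m n h \<equiv> {(g, f). g \<in> C m n \<and> f \<in> C l m \<and> compose {1..l} g f = h}"

lemma finite_hom [simp]: "finite (C m n)"
  using finite_subset[OF hom_PiE] by (simp add: finite_PiE)

lemma finite_factorizations [simp]: "finite (factorizations l m n h)"
  by (rule finite_subset[of _ "C m n \<times> C l m"]) auto

lemma comp_closed: "l \<ge> 1 \<Longrightarrow> m \<ge> 1 \<Longrightarrow> n \<ge> 1 \<Longrightarrow> f \<in> C l m \<Longrightarrow> g \<in> C m n \<Longrightarrow> compose {1..l} g f \<in> C l n"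
  using category unfolding category_def by blast

lemma id_closed: "n \<ge> 1 \<Longrightarrow> (\<lambda>i\<in>{1..n}. i) \<in> C n n"
  using category unfolding category_def by blast

lemma comp_assoc:
  "f \<in> C l m \<Longrightarrow> compose {1..l} h (compose {1..l} g f) = compose {1..l} (compose {1..m} h g) f"
  using hom_PiE by (intro compose_assoc) blast

lemma comp_id: "f \<in> C l m \<Longrightarrow> compose {1..l} (\<lambda>i\<in>{1..m}. i) f = f"
  using hom_PiE by (fastforce simp: compose_def fun_eq_iff PiE_iff extensional_def)

lemma id_comp: "f \<in> C l m \<Longrightarrow> compose {1..l} f (\<lambda>i\<in>{1..l}. i) = f"
  using hom_PiE by (fastforce simp: compose_def fun_eq_iff PiE_iff extensional_def)

section \<open>Bilinear composition: coefficients, units, associativity\<close>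

lemma lin_comp_closed:
  assumes "y \<in> kC m n" "x \<in> kC l m"
  shows "lin_comp k C l m n y x \<in> kC l n"
  unfolding lin_comp_def free_module_simps using assms by (auto intro!: finsum_closed)

lemma lin_comp_linear_right:
  assumes "y \<in> kC m n"
  shows "lin_comp k C l m n y \<in> linear_maps k (free_module k (C l m)) (free_module k (C l n))"
proof -
  have "lin_comp k C l m n y (x \<oplus>\<^bsub>free_module k (C l m)\<^esub> x') =
      lin_comp k C l m n y x \<oplus>\<^bsub>free_module k (C l n)\<^esub> lin_comp k C l m n y x'"
    if "x \<in> kC l m" "x' \<in> kC l m" for x x'
  proof -
    have "(\<Oplus>p\<in>factorizations l m n h. y (fst p) \<otimes> (x \<oplus>\<^bsub>free_module k (C l m)\<^esub> x') (snd p)) =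
      (\<Oplus>p\<in>factorizations l m n h. y (fst p) \<otimes> x (snd p) \<oplus> y (fst p) \<otimes> x' (snd p))" for h
      using assms that by (intro finsum_cong') (auto simp: free_module_simps(3) r_distr)
    also have "\<dots> h = (\<Oplus>p\<in>factorizations l m n h. y (fst p) \<otimes> x (snd p)) \<oplus>
        (\<Oplus>p\<in>factorizations l m n h. y (fst p) \<otimes> x' (snd p))" for h
      using assms that by (intro finsum_addf) auto
    finally show ?thesis by (auto simp: lin_comp_def free_module_simps(3) intro!: restrict_ext)
  qed
  moreover have "lin_comp k C l m n y (a \<odot>\<^bsub>free_module k (C l m)\<^esub> x) =
      a \<odot>\<^bsub>free_module k (C l n)\<^esub> lin_comp k C l m n y x"
    if "a \<in> carrier k" "x \<in> kC l m" for a x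
  proof -
    have "a \<otimes> (\<Oplus>p\<in>factorizations l m n h. y (fst p) \<otimes> x (snd p)) =
        (\<Oplus>p\<in>factorizations l m n h. a \<otimes> (y (fst p) \<otimes> x (snd p)))" for h
      using assms that by (intro finsum_rdistr) auto
    also have "\<dots> h = (\<Oplus>p\<in>factorizations l m n h. y (fst p) \<otimes> (a \<odot>\<^bsub>free_module k (C l m)\<^esub> x) (snd p))" for h
      using assms that by (intro finsum_cong') (auto simp: free_module_simps(4) m_lcomm)
    finally show ?thesis by (auto simp: lin_comp_def free_module_simps(4) intro!: restrict_ext)
  qed
  ultimately show ?thesis using assms by (auto simp: linear_maps_def lin_comp_closed)
qed

lemma lin_comp_linear_left:
  assumes "x \<in> kC l m"
  shows "(\<lambda>y. lin_comp k C l m n y x) \<in> linear_maps k (free_module k (C m n)) (free_module k (C l n))"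
proof -
  have "lin_comp k C l m n (y \<oplus>\<^bsub>free_module k (C m n)\<^esub> y') x =
      lin_comp k C l m n y x \<oplus>\<^bsub>free_module k (C l n)\<^esub> lin_comp k C l m n y' x"
    if "y \<in> kC m n" "y' \<in> kC m n" for y y'
  proof -
    have "(\<Oplus>p\<in>factorizations l m n h. (y \<oplus>\<^bsub>free_module k (C m n)\<^esub> y') (fst p) \<otimes> x (snd p)) =
      (\<Oplus>p\<in>factorizations l m n h. y (fst p) \<otimes> x (snd p) \<oplus> y' (fst p) \<otimes> x (snd p))" for h
      using assms that by (intro finsum_cong') (auto simp: free_module_simps(3) l_distr)
    also have "\<dots> h = (\<Oplus>p\<in>factorizations l m n h. y (fst p) \<otimes> x (snd p)) \<oplus>
        (\<Oplus>p\<in>factorizations l m n h. y' (fst p) \<otimes> x (snd p))" for h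
      using assms that by (intro finsum_addf) auto
    finally show ?thesis by (auto simp: lin_comp_def free_module_simps(3) intro!: restrict_ext)
  qed
  moreover have "lin_comp k C l m n (a \<odot>\<^bsub>free_module k (C m n)\<^esub> y) x =
      a \<odot>\<^bsub>free_module k (C l n)\<^esub> lin_comp k C l m n y x"
    if "a \<in> carrier k" "y \<in> kC m n" for a y
  proof -
    have "a \<otimes> (\<Oplus>p\<in>factorizations l m n h. y (fst p) \<otimes> x (snd p)) =
        (\<Oplus>p\<in>factorizations l m n h. a \<otimes> (y (fst p) \<otimes> x (snd p)))" for h
      using assms that by (intro finsum_rdistr) auto
    also have "\<dots> h = (\<Oplus>p\<in>factorizations l m n h. (a \<odot>\<^bsub>free_module k (C m n)\<^esub> y) (fst p) \<otimes> x (snd p))" for h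
      using assms that by (intro finsum_cong') (auto simp: free_module_simps(4) m_assoc)
    finally show ?thesis by (auto simp: lin_comp_def free_module_simps(4) intro!: restrict_ext)
  qed
  ultimately show ?thesis using assms by (auto simp: linear_maps_def lin_comp_closed)
qed

text \<open>Pairs whose second component is not \<open>f\<close> contribute zero, which leaves the
  fibre of precomposition with \<open>f\<close> over \<open>h\<close>. Later statements about
  multiplication by \<open>shift\<close> or \<open>wrap\<close> are statements about such
  fibres.\<close>

lemma lin_comp_basis_right:
  assumes "x \<in> kC m n" "f \<in> C l m" "h \<in> C l n"
  shows "lin_comp k C l m n x (basis k (C l m) f) h = (\<Oplus>g\<in>{g \<in> C m n. compose {1..l} g f = h}. x g)"
proof -
  let ?A = "{g \<in> C m n. compose {1..l} g f = h}"
  have "(\<Oplus>g\<in>?A. x g) = (\<Oplus>p\<in>(\<lambda>g. (g, f)) ` ?A. x (fst p))"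
    using assms by (subst finsum_reindex) (auto simp: inj_on_def)
  also have "\<dots> = (\<Oplus>p\<in>factorizations l m n h. x (fst p) \<otimes> basis k (C l m) f (snd p))"
    using assms by (intro add.finprod_mono_neutral_cong_left) (auto simp: basis_def)
  finally show ?thesis using assms by (simp add: lin_comp_def)
qed

lemma lin_comp_basis_left:
  assumes "x \<in> kC l m" "g \<in> C m n" "h \<in> C l n"
  shows "lin_comp k C l m n (basis k (C m n) g) x h = (\<Oplus>f\<in>{f \<in> C l m. compose {1..l} g f = h}. x f)"
proof -
  let ?A = "{f \<in> C l m. compose {1..l} g f = h}"
  have "(\<Oplus>f\<in>?A. x f) = (\<Oplus>p\<in>(\<lambda>f. (g, f)) ` ?A. x (snd p))"
    using assms by (subst finsum_reindex) (auto simp: inj_on_def)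
  also have "\<dots> = (\<Oplus>p\<in>factorizations l m n h. basis k (C m n) g (fst p) \<otimes> x (snd p))"
    using assms by (intro add.finprod_mono_neutral_cong_left) (auto simp: basis_def)
  finally show ?thesis using assms by (simp add: lin_comp_def)
qed

lemma lin_comp_id_left:
  assumes "m \<ge> 1" "x \<in> kC l m"
  shows "lin_comp k C l m m (basis k (C m m) (\<lambda>i\<in>{1..m}. i)) x = x"
proof (rule free_module_eqI[OF lin_comp_closed[OF basis_closed assms(2)] assms(2)])
  fix h assume h: "h \<in> C l m"
  then have "{f \<in> C l m. compose {1..l} (\<lambda>i\<in>{1..m}. i) f = h} = {h}" by (auto simp: comp_id)
  then show "lin_comp k C l m m (basis k (C m m) (\<lambda>i\<in>{1..m}. i)) x h = x h"
    using lin_comp_basis_left[OF assms(2) id_closed[OF assms(1)] h] assms(2) h by simp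
qed

lemma lin_comp_id_right:
  assumes "m \<ge> 1" "x \<in> kC m n"
  shows "lin_comp k C m m n x (basis k (C m m) (\<lambda>i\<in>{1..m}. i)) = x"
proof (rule free_module_eqI[OF lin_comp_closed[OF assms(2) basis_closed] assms(2)])
  fix h assume h: "h \<in> C m n"
  then have "{g \<in> C m n. compose {1..m} g (\<lambda>i\<in>{1..m}. i) = h} = {h}" by (auto simp: id_comp)
  then show "lin_comp k C m m n x (basis k (C m m) (\<lambda>i\<in>{1..m}. i)) h = x h"
    using lin_comp_basis_right[OF assms(2) id_closed[OF assms(1)] h] assms(2) h by simp
qed

lemma basis_comp:
  assumes "f \<in> C l m" "g \<in> C m n"
  shows "lin_comp k C l m n (basis k (C m n) g) (basis k (C l m) f) =
    basis k (C l n) (compose {1..l} g f)"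
proof (rule free_module_eqI[OF lin_comp_closed[OF basis_closed basis_closed] basis_closed])
  fix h assume h: "h \<in> C l n"
  have "(\<Oplus>f'\<in>{f' \<in> C l m. compose {1..l} g f' = h}. basis k (C l m) f f') =
      basis k (C l n) (compose {1..l} g f) h"
  proof (cases "compose {1..l} g f = h")
    case True
    then have "(\<Oplus>f'\<in>{f' \<in> C l m. compose {1..l} g f' = h}. basis k (C l m) f f') = basis k (C l m) f f"
      using assms(1) by (intro finsum_eq_single) (auto simp: basis_def)
    then show ?thesis using True h assms(1) by (simp add: basis_def)
  next
    case False
    then have "(\<Oplus>f'\<in>{f' \<in> C l m. compose {1..l} g f' = h}. basis k (C l m) f f') = \<zero>"
      by (intro add.finprod_one_eqI) (auto simp: basis_def)
    then show ?thesis using False h by (simp add: basis_def)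
  qed
  then show "lin_comp k C l m n (basis k (C m n) g) (basis k (C l m) f) h =
      basis k (C l n) (compose {1..l} g f) h"
    using lin_comp_basis_left[OF basis_closed assms(2) h] by simp
qed

text \<open>Both sides are the sum of \<open>z c y b x a\<close> over the set \<open>S\<close> of
  triples with total composite \<open>h\<close>: the left side groups the triples by the pair
  \<open>(c, b a)\<close> through \<phi>, the right side by \<open>(c b, a)\<close> through
  \<psi>.\<close>

lemma lin_comp_assoc:
  assumes lmnq: "l \<ge> 1" "m \<ge> 1" "n \<ge> 1" "q \<ge> 1"
    and z: "z \<in> kC n q" and y: "y \<in> kC m n" and x: "x \<in> kC l m"
  shows "lin_comp k C l n q z (lin_comp k C l m n y x) = lin_comp k C l m q (lin_comp k C m n q z y) x"
proof (rule free_module_eqI)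
  show "lin_comp k C l n q z (lin_comp k C l m n y x) \<in> kC l q"
    "lin_comp k C l m q (lin_comp k C m n q z y) x \<in> kC l q"
    by (intro lin_comp_closed x y z)+
  fix h assume h: "h \<in> C l q"
  define S where "S = {(c, b, a). c \<in> C n q \<and> b \<in> C m n \<and> a \<in> C l m \<and>
    compose {1..l} c (compose {1..l} b a) = h}"
  define F where "F = (\<lambda>(c, b, a). z c \<otimes> (y b \<otimes> x a))"
  have S_fin: "finite S"
    by (rule finite_subset[of _ "C n q \<times> C m n \<times> C l m"]) (auto simp: S_def)
  have F_cl: "F \<in> S \<rightarrow> carrier k" using x y z by (auto simp: S_def F_def)
  define \<phi> where "\<phi> = (\<lambda>(c, b, a). (c :: nat \<Rightarrow> nat, compose {1..l} b (a :: nat \<Rightarrow> nat) :: nat \<Rightarrow> nat))"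
  define \<psi> where "\<psi> = (\<lambda>(c, b, a). (compose {1..m} c (b :: nat \<Rightarrow> nat) :: nat \<Rightarrow> nat, a :: nat \<Rightarrow> nat))"
  have "z c \<otimes> lin_comp k C l m n y x e = (\<Oplus>s\<in>{s \<in> S. \<phi> s = (c, e)}. F s)"
    if "(c, e) \<in> factorizations l n q h" for c e
  proof -
    have "z c \<otimes> lin_comp k C l m n y x e = z c \<otimes> (\<Oplus>p\<in>factorizations l m n e. y (fst p) \<otimes> x (snd p))"
      using that unfolding lin_comp_def by auto
    also have "\<dots> = (\<Oplus>p\<in>factorizations l m n e. z c \<otimes> (y (fst p) \<otimes> x (snd p)))"
      using that x y z by (intro finsum_rdistr) auto
    also have "\<dots> = (\<Oplus>p\<in>factorizations l m n e. F (c, p))"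
      using that x y z by (intro finsum_cong') (auto simp: F_def)
    also have "\<dots> = (\<Oplus>s\<in>Pair c ` factorizations l m n e. F s)"
      using x y z that by (subst finsum_reindex) (auto simp: inj_on_def F_def)
    also have "Pair c ` factorizations l m n e = {s \<in> S. \<phi> s = (c, e)}"
      using that by (auto simp: S_def \<phi>_def)
    finally show ?thesis .
  qed
  then have "lin_comp k C l n q z (lin_comp k C l m n y x) h =
      (\<Oplus>p\<in>factorizations l n q h. \<Oplus>s\<in>{s \<in> S. \<phi> s = p}. F s)"
    unfolding lin_comp_def[of k C l n q] using h S_fin F_cl
    by (auto intro!: finsum_cong' finsum_closed)
  also have "\<dots> = (\<Oplus>s\<in>S. F s)"
    using lmnq by (intro finsum_fibers S_fin F_cl) (auto simp: S_def \<phi>_def comp_closed)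
  also have "\<dots> = (\<Oplus>p\<in>factorizations l m q h. \<Oplus>s\<in>{s \<in> S. \<psi> s = p}. F s)"
    using lmnq by (intro finsum_fibers[symmetric] S_fin F_cl)
      (auto simp: S_def \<psi>_def comp_closed comp_assoc)
  also have "\<dots> = lin_comp k C l m q (lin_comp k C m n q z y) x h"
  proof -
    have "lin_comp k C m n q z y d \<otimes> x a = (\<Oplus>s\<in>{s \<in> S. \<psi> s = (d, a)}. F s)"
      if "(d, a) \<in> factorizations l m q h" for d a
    proof -
      have "lin_comp k C m n q z y d \<otimes> x a = (\<Oplus>p\<in>factorizations m n q d. z (fst p) \<otimes> y (snd p)) \<otimes> x a"
        using that unfolding lin_comp_def by auto
      also have "\<dots> = (\<Oplus>p\<in>factorizations m n q d. z (fst p) \<otimes> y (snd p) \<otimes> x a)"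
        using that x y z by (intro finsum_ldistr) auto
      also have "\<dots> = (\<Oplus>p\<in>factorizations m n q d. F (fst p, snd p, a))"
        using that x y z by (intro finsum_cong') (auto simp: F_def m_assoc)
      also have "\<dots> = (\<Oplus>s\<in>(\<lambda>p. (fst p, snd p, a)) ` factorizations m n q d. F s)"
        using x y z that by (subst finsum_reindex) (auto simp: inj_on_def F_def)
      also have "(\<lambda>p. (fst p, snd p, a)) ` factorizations m n q d = {s \<in> S. \<psi> s = (d, a)}"
        using that by (force simp: S_def \<psi>_def comp_assoc)
      finally show ?thesis .
    qed
    then show ?thesis
      unfolding lin_comp_def[of k C l m q] using h S_fin F_cl
      by (auto intro!: finsum_cong' finsum_closed)
  qed
  finally show "lin_comp k C l n q z (lin_comp k C l m n y x) h =
      lin_comp k C l m q (lin_comp k C m n q z y) x h" .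
qed

section \<open>Representable modules and their projectivity\<close>

lemma representable_simps [simp]:
  "obj (representable k C n) l = free_module k (C n l)"
  "act (representable k C n) l m f = lin_comp k C n l m (basis k (C l m) f)"
  by (simp_all add: representable_def)

lemma is_cat_module_representable:
  assumes "n \<ge> 1"
  shows "is_cat_module k C (representable k C n)"
  unfolding is_cat_module_def
proof (intro conjI allI impI ballI)
  fix l p q :: nat and f g x
  assume "l \<ge> 1" "p \<ge> 1" "q \<ge> 1" "f \<in> C l p" "g \<in> C p q" "x \<in> carrier (obj (representable k C n) l)"
  with assms show "act (representable k C n) l q (compose {1..l} g f) x =
      act (representable k C n) p q g (act (representable k C n) l p f x)"
    by (simp add: lin_comp_assoc basis_comp)
qed (use assms in \<open>auto simp: module_free_module lin_comp_linear_right lin_comp_id_left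
  simp del: restrict_apply\<close>)

text \<open>The linear extension of the assignment that sends a morphism \<open>f\<close> to its
  action on \<open>v\<close>; it is the homomorphism that takes the identity of \<open>n\<close> to
  \<open>v\<close>.\<close>

lemma yoneda:
  assumes n: "n \<ge> 1" and M: "is_cat_module k C M" and v: "v \<in> carrier (obj M n)"
  shows "(\<lambda>l x. \<Oplus>\<^bsub>obj M l\<^esub>f\<in>C n l. x f \<odot>\<^bsub>obj M l\<^esub> act M n l f v) \<in> cat_module_hom k C (representable k C n) M"
  (is "?\<psi> \<in> _")
  unfolding cat_module_hom_def
proof (intro CollectI conjI allI impI ballI)
  fix l :: nat assume l: "l \<ge> 1"
  interpret M: module k "obj M l" by (rule cat_moduleD(1)[OF M l])
  have [simp]: "act M n l f v \<in> carrier (obj M l)" if "f \<in> C n l" for f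
    by (rule linear_mapsD(1)[OF cat_moduleD(2)[OF M n l that] v])
  have "?\<psi> l (x \<oplus>\<^bsub>free_module k (C n l)\<^esub> y) = ?\<psi> l x \<oplus>\<^bsub>obj M l\<^esub> ?\<psi> l y"
    if "x \<in> kC n l" "y \<in> kC n l" for x y
  proof -
    have "?\<psi> l (x \<oplus>\<^bsub>free_module k (C n l)\<^esub> y) =
        (\<Oplus>\<^bsub>obj M l\<^esub>f\<in>C n l. x f \<odot>\<^bsub>obj M l\<^esub> act M n l f v \<oplus>\<^bsub>obj M l\<^esub> y f \<odot>\<^bsub>obj M l\<^esub> act M n l f v)"
      using that by (intro M.finsum_cong') (auto simp: free_module_simps(3) M.smult_l_distr)
    also have "\<dots> = ?\<psi> l x \<oplus>\<^bsub>obj M l\<^esub> ?\<psi> l y"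
      using that by (intro M.finsum_addf) auto
    finally show ?thesis .
  qed
  moreover have "?\<psi> l (a \<odot>\<^bsub>free_module k (C n l)\<^esub> x) = a \<odot>\<^bsub>obj M l\<^esub> ?\<psi> l x"
    if "a \<in> carrier k" "x \<in> kC n l" for a x
    using that by (subst M.finsum_smult_ldistr)
      (auto simp: free_module_simps(4) M.smult_assoc1 intro!: M.finsum_cong')
  ultimately show "?\<psi> l \<in> linear_maps k (obj (representable k C n) l) (obj M l)"
    by (auto simp: linear_maps_def intro!: M.finsum_closed)
next
  fix l m :: nat and g x
  assume l: "l \<ge> 1" and m: "m \<ge> 1" and g: "g \<in> C l m" and x: "x \<in> carrier (obj (representable k C n) l)"
  interpret L: module k "obj M l" by (rule cat_moduleD(1)[OF M l])
  interpret M: module k "obj M m" by (rule cat_moduleD(1)[OF M m])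
  note g_lin = cat_moduleD(2)[OF M l m g]
  have [simp]: "act M n l f v \<in> carrier (obj M l)" if "f \<in> C n l" for f
    by (rule linear_mapsD(1)[OF cat_moduleD(2)[OF M n l that] v])
  have [simp]: "act M n m f v \<in> carrier (obj M m)" if "f \<in> C n m" for f
    by (rule linear_mapsD(1)[OF cat_moduleD(2)[OF M n m that] v])
  have x: "x \<in> kC n l" using x by simp
  let ?F = "\<lambda>f. x f \<odot>\<^bsub>obj M m\<^esub> act M n m (compose {1..n} g f) v"
  have F: "?F f \<in> carrier (obj M m)" if "f \<in> C n l" for f
    using that x comp_closed[OF n l m that g] by simp
  have "act M l m g (?\<psi> l x) = (\<Oplus>\<^bsub>obj M m\<^esub>f\<in>C n l. act M l m g (x f \<odot>\<^bsub>obj M l\<^esub> act M n l f v))"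
    using x by (intro linear_maps_finsum[OF L.module_axioms M.module_axioms g_lin]) auto
  also have "\<dots> = (\<Oplus>\<^bsub>obj M m\<^esub>f\<in>C n l. ?F f)"
    using x F by (intro M.finsum_cong')
      (auto simp: linear_mapsD(3)[OF g_lin] cat_moduleD(4)[OF M n l m _ g v])
  \<comment> \<open>Collect the \<open>f\<close> with the same composite \<open>h\<close> with
    \<open>g\<close>: their coefficients add up to the coefficient of \<open>g x\<close> at
    \<open>h\<close>.\<close>
  also have "\<dots> = (\<Oplus>\<^bsub>obj M m\<^esub>h\<in>C n m. \<Oplus>\<^bsub>obj M m\<^esub>f\<in>{f \<in> C n l. compose {1..n} g f = h}. ?F f)"
    using F comp_closed[OF n l m _ g] by (intro M.finsum_fibers[symmetric]) auto
  also have "\<dots> = ?\<psi> m (act (representable k C n) l m g x)"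
  proof (rule M.finsum_cong'[OF refl])
    fix h assume h: "h \<in> C n m"
    have *: "finsum (obj M m) (\<lambda>f. x f \<odot>\<^bsub>obj M m\<^esub> w) A = finsum k x A \<odot>\<^bsub>obj M m\<^esub> w"
      if "finite A" "A \<subseteq> C n l" "w \<in> carrier (obj M m)" for A w
      using that
    proof (induction A)
      case (insert a A)
      then have "x \<in> A \<rightarrow> carrier k" using x by auto
      with insert x show ?case by (simp add: Pi_iff M.smult_l_distr)
    qed simp
    have "(\<Oplus>\<^bsub>obj M m\<^esub>f\<in>{f \<in> C n l. compose {1..n} g f = h}. ?F f) =
        (\<Oplus>\<^bsub>obj M m\<^esub>f\<in>{f \<in> C n l. compose {1..n} g f = h}. x f \<odot>\<^bsub>obj M m\<^esub> act M n m h v)"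
      using x h by (intro M.finsum_cong') auto
    also have "\<dots> = (\<Oplus>f\<in>{f \<in> C n l. compose {1..n} g f = h}. x f) \<odot>\<^bsub>obj M m\<^esub> act M n m h v"
      using h by (intro *) auto
    finally show "(\<Oplus>\<^bsub>obj M m\<^esub>f\<in>{f \<in> C n l. compose {1..n} g f = h}. ?F f) =
        act (representable k C n) l m g x h \<odot>\<^bsub>obj M m\<^esub> act M n m h v"
      using lin_comp_basis_left[OF x g h] by simp
  next
    show "(\<lambda>h. act (representable k C n) l m g x h \<odot>\<^bsub>obj M m\<^esub> act M n m h v) \<in> C n m \<rightarrow> carrier (obj M m)"
      using free_module_eval[OF lin_comp_closed[OF basis_closed x]] by auto
  qed
  finally show "?\<psi> m (act (representable k C n) l m g x) = act M l m g (?\<psi> l x)" by simp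
qed

text \<open>A preimage \<open>v\<close> of the image of the identity determines a homomorphism by
  \<open>yoneda\<close>. It lifts \<phi> because this holds on basis elements, each of which is the
  action of a morphism on the identity.\<close>

lemma projective_representable:
  assumes n: "n \<ge> 1"
  shows "projective TYPE('b) TYPE('c) k C (representable k C n)"
  unfolding projective_def
proof (intro conjI is_cat_module_representable n allI impI ballI)
  fix M :: "('r, 'b) cat_module" and N :: "('r, 'c) cat_module" and \<eta> \<phi>
  assume M: "is_cat_module k C M" and N: "is_cat_module k C N"
    and \<eta>: "\<eta> \<in> cat_module_hom k C M N" and \<phi>: "\<phi> \<in> cat_module_hom k C (representable k C n) N"
    and surj: "\<forall>n\<ge>1. \<eta> n ` carrier (obj M n) = carrier (obj N n)"
  let ?id = "basis k (C n n) (\<lambda>i\<in>{1..n}. i)"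
  have "\<phi> n ?id \<in> carrier (obj N n)"
    using linear_mapsD(1)[OF cat_module_homD(1)[OF \<phi> n], of ?id] by simp
  then obtain v where v: "v \<in> carrier (obj M n)" "\<eta> n v = \<phi> n ?id"
    using surj n by (metis imageE)
  let ?\<psi> = "\<lambda>l x. \<Oplus>\<^bsub>obj M l\<^esub>f\<in>C n l. x f \<odot>\<^bsub>obj M l\<^esub> act M n l f v"
  have "\<eta> l (?\<psi> l x) = \<phi> l x" if l: "l \<ge> 1" and x: "x \<in> kC n l" for l x
  proof -
    interpret M: module k "obj M l" by (rule cat_moduleD(1)[OF M l])
    interpret N: module k "obj N l" by (rule cat_moduleD(1)[OF N l])
    interpret P: module k "free_module k (C n l)" by (rule module_free_module)
    have \<phi>l: "\<phi> l \<in> linear_maps k (free_module k (C n l)) (obj N l)"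
      using cat_module_homD(1)[OF \<phi> l] by simp
    note lin = linear_mapsD[OF \<phi>l] linear_mapsD[OF cat_module_homD(1)[OF \<eta> l]]
    have [simp]: "act M n l f v \<in> carrier (obj M l)" if "f \<in> C n l" for f
      by (rule linear_mapsD(1)[OF cat_moduleD(2)[OF M n l that] v(1)])
    have f: "\<eta> l (act M n l f v) = \<phi> l (basis k (C n l) f)" if "f \<in> C n l" for f
      using cat_module_homD(2)[OF \<eta> n l that v(1)] cat_module_homD(2)[OF \<phi> n l that, of ?id] v(2)
        lin_comp_id_right[OF n basis_closed] by simp
    have "\<eta> l (?\<psi> l x) = (\<Oplus>\<^bsub>obj N l\<^esub>f\<in>C n l. \<phi> l (x f \<odot>\<^bsub>free_module k (C n l)\<^esub> basis k (C n l) f))"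
      using x lin f by (subst linear_maps_finsum[OF M.module_axioms N.module_axioms
            cat_module_homD(1)[OF \<eta> l]]) (auto intro!: N.finsum_cong')
    also have "\<dots> = \<phi> l (\<Oplus>\<^bsub>free_module k (C n l)\<^esub>f\<in>C n l. x f \<odot>\<^bsub>free_module k (C n l)\<^esub> basis k (C n l) f)"
      using x by (intro linear_maps_finsum[OF P.module_axioms N.module_axioms \<phi>l, symmetric]) auto
    also have "(\<Oplus>\<^bsub>free_module k (C n l)\<^esub>f\<in>C n l. x f \<odot>\<^bsub>free_module k (C n l)\<^esub> basis k (C n l) f) = x"
      by (rule free_module_expansion[OF finite_hom x])
    finally show ?thesis .
  qed
  then show "\<exists>\<psi>\<in>cat_module_hom k C (representable k C n) M.
      \<forall>l\<ge>1. \<forall>x\<in>carrier (obj (representable k C n) l). \<eta> l (\<psi> l x) = \<phi> l x"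
    using yoneda[OF n M v(1)] by (intro bexI[of _ ?\<psi>]) auto
qed

end

section \<open>Right multiplication by the idempotent\<close>

text \<open>The endomorphism \<open>d_i s_i\<close> in closed form. Its image misses exactly the
  point \<open>i\<close>.\<close>

definition shift :: "nat \<Rightarrow> nat \<Rightarrow> nat \<Rightarrow> nat" where
  "shift n i = (\<lambda>j\<in>{1..n}. if j = i then i + 1 else j)"

lemma coface_codegeneracy:
  assumes "1 \<le> i" "i < n"
  shows "compose {1..n} (coface n i) (codegeneracy n i) = shift n i"
  using assms by (auto simp: compose_def coface_def codegeneracy_def shift_def intro!: restrict_ext)

lemma shift_in_OA: "1 \<le> i \<Longrightarrow> i < n \<Longrightarrow> shift n i \<in> OA n n"
  by (auto simp: OA_def shift_def mono_on_def)

text \<open>The surjection \<open>q\<close> of the overview.\<close>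

definition wrap :: "nat \<Rightarrow> nat \<Rightarrow> nat" where
  "wrap n = (\<lambda>j\<in>{1..n}. if j = n then 1 else j)"

text \<open>The simplicial notion: for morphisms of \<open>C\<close>, it says that \<open>h\<close>
  factors through no \<open>s_i\<close>. The values at \<open>n\<close> and \<open>1\<close> are not
  compared, which leaves room for the additional nondegenerate maps of \<open>CA\<close> and
  \<open>SA\<close>.\<close>

definition nondegenerate :: "nat \<Rightarrow> (nat \<Rightarrow> nat) \<Rightarrow> bool" where
  "nondegenerate n h \<longleftrightarrow> (\<forall>i. 1 \<le> i \<and> i < n \<longrightarrow> h i \<noteq> h (i + 1))"

lemma inj_imp_nondegenerate: "inj_on h {1..n} \<Longrightarrow> nondegenerate n h"
  by (fastforce simp: nondegenerate_def dest: inj_onD)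

lemma compose_shift_degenerate:
  assumes "compose {1..n} g (shift n i) = h" "1 \<le> i" "i < n"
  shows "h i = h (i + 1)"
  using assms by (auto simp: compose_def shift_def)

context linearised_category
begin

section \<open>The coefficients of a product with \<open>Psi\<close>\<close>

text \<open>The action multiplies from the left, so compatibility with it is associativity. Both
  \<open>Psi\<close> and \<open>wrap\<close> act in this way.\<close>

lemma right_mult_hom:
  assumes "m \<ge> 1" "n \<ge> 1" "g \<in> kC m n"
  shows "(\<lambda>l x. lin_comp k C m n l x g) \<in> cat_module_hom k C (representable k C n) (representable k C m)"
  unfolding cat_module_hom_def using assms by (auto simp: lin_comp_linear_left lin_comp_assoc)

lemma Psi_partial_closed:
  assumes "n \<ge> 1"
  shows "Psi_partial k C n j \<in> kC n n"
proof (induction j)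
  case (Suc j)
  interpret F: module k "free_module k (C n n)" by (rule module_free_module)
  show ?case using Suc by (simp add: lin_comp_closed)
qed simp

text \<open>The recursion behind both vanishing and preservation: the new rightmost factor subtracts
  from the coefficient at \<open>h\<close> the sum over the fibre of precomposition with
  \<open>d_i s_i\<close>, where \<open>i = Suc j\<close>.\<close>

lemma Psi_partial_Suc:
  assumes n: "n \<ge> 1" "l \<ge> 1" and x: "x \<in> kC n l" and h: "h \<in> C n l" and j: "Suc j < n"
  shows "lin_comp k C n n l x (Psi_partial k C n (Suc j)) h =
    lin_comp k C n n l x (Psi_partial k C n j) h \<ominus>
    (\<Oplus>g\<in>{g \<in> C n l. compose {1..n} g (shift n (Suc j)) = h}. lin_comp k C n n l x (Psi_partial k C n j) g)"
proof -
  interpret F: module k "free_module k (C n n)" by (rule module_free_module)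
  let ?id = "basis k (C n n) (\<lambda>i\<in>{1..n}. i)" and ?s = "basis k (C n n) (shift n (Suc j))"
  let ?y = "lin_comp k C n n l x (Psi_partial k C n j)"
  have y: "?y \<in> kC n l" using x n by (intro lin_comp_closed Psi_partial_closed)
  have s: "shift n (Suc j) \<in> C n n" using shift_in_OA[of "Suc j" n] OA_subset j by auto
  have "lin_comp k C n n l x (Psi_partial k C n (Suc j)) =
      lin_comp k C n n l ?y (?id \<ominus>\<^bsub>free_module k (C n n)\<^esub> ?s)"
    using n j x by (simp add: coface_codegeneracy lin_comp_assoc Psi_partial_closed)
  also have "\<dots> = ?y \<ominus>\<^bsub>free_module k (C n l)\<^esub> lin_comp k C n n l ?y ?s"
    using linear_maps_minus[OF module_free_module module_free_module lin_comp_linear_right[OF y]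
        basis_closed basis_closed] lin_comp_id_right[OF n(1) y] by simp
  finally show ?thesis
    using free_module_minus[OF lin_comp_closed[OF y basis_closed] h] lin_comp_basis_right[OF y s h]
    by simp
qed

lemma Psi_closed: "n \<ge> 1 \<Longrightarrow> Psi k C n \<in> kC n n"
  by (simp add: Psi_def Psi_partial_closed)

abbreviation mult_Psi :: "nat \<Rightarrow> nat \<Rightarrow> ((nat \<Rightarrow> nat) \<Rightarrow> 'r) \<Rightarrow> (nat \<Rightarrow> nat) \<Rightarrow> 'r" where
  "mult_Psi n l x \<equiv> lin_comp k C n n l x (Psi k C n)"

text \<open>No factor changes the coefficient at \<open>h\<close>, because a map of the form
  \<open>g d_i s_i\<close> repeats its value at \<open>i\<close> and \<open>i + 1\<close>, so the
  fibre over \<open>h\<close> is empty.\<close>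

lemma mult_Psi_nondegenerate:
  assumes "n \<ge> 1" "l \<ge> 1" "x \<in> kC n l" "h \<in> C n l" "nondegenerate n h"
  shows "mult_Psi n l x h = x h"
proof -
  have "lin_comp k C n n l x (Psi_partial k C n j) h = x h" if "j < n" for j
    using that
  proof (induction j)
    case 0
    then show ?case using lin_comp_id_right[OF assms(1,3)] by simp
  next
    case (Suc j)
    have "h (Suc j) \<noteq> h (Suc j + 1)"
      using assms(5) Suc.prems unfolding nondegenerate_def by (metis le_add1 plus_1_eq_Suc)
    then have "{g \<in> C n l. compose {1..n} g (shift n (Suc j)) = h} = {}"
      using compose_shift_degenerate[of n _ "Suc j" h] Suc.prems by auto
    then have "lin_comp k C n n l x (Psi_partial k C n (Suc j)) h =
        lin_comp k C n n l x (Psi_partial k C n j) h \<ominus> \<zero>"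
      using Psi_partial_Suc[OF assms(1-4) Suc.prems] by (simp only: finsum_empty)
    then show ?case using Suc assms(3,4) by (simp add: a_minus_def)
  qed
  from this[of "n - 1"] show ?thesis using assms(1) by (simp add: Psi_def)
qed

text \<open>
  After multiplication with the first \<open>j\<close> factors, the support only contains maps with
  \<open>h i = h (i + 1)\<close> for some \<open>i > j\<close>. For \<open>i = j + 1\<close> such a map is fixed by \<open>s\<^sub>i\<close> followed by \<open>d\<^sub>i\<close>, so the
  next factor removes it.
\<close>

lemma mult_Psi_degenerate:
  assumes "n \<ge> 1" "l \<ge> 1" "x \<in> kC n l" "\<And>h. h \<in> C n l \<Longrightarrow> nondegenerate n h \<Longrightarrow> x h = \<zero>"
  shows "mult_Psi n l x = \<zero>\<^bsub>free_module k (C n l)\<^esub>"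
proof -
  have "lin_comp k C n n l x (Psi_partial k C n j) h = \<zero>"
    if "j < n" "h \<in> C n l" "\<And>i. j < i \<Longrightarrow> i < n \<Longrightarrow> h i \<noteq> h (i + 1)" for j h
    using that
  proof (induction j arbitrary: h)
    case 0
    then show ?case using lin_comp_id_right[OF assms(1,3)] assms(4)[of h]
      by (simp add: nondegenerate_def)
  next
    case (Suc j)
    let ?y = "lin_comp k C n n l x (Psi_partial k C n j)"
    let ?A = "{g \<in> C n l. compose {1..n} g (shift n (Suc j)) = h}"
    have y: "?y g \<in> carrier k" if "g \<in> C n l" for g
      using free_module_eval[OF lin_comp_closed[OF assms(3) Psi_partial_closed[OF assms(1)]] that] .
    have eq: "lin_comp k C n n l x (Psi_partial k C n (Suc j)) h = ?y h \<ominus> (\<Oplus>g\<in>?A. ?y g)"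
      by (rule Psi_partial_Suc[OF assms(1-3) Suc.prems(2,1)])
    show ?case
    proof (cases "h (Suc j) = h (Suc j + 1)")
      case False
      then have "?A = {}" using compose_shift_degenerate[of n _ "Suc j" h] Suc.prems(1) by auto
      then have "(\<Oplus>g\<in>?A. ?y g) = \<zero>" by (simp only: finsum_empty)
      moreover have "?y h = \<zero>"
      proof (rule Suc.IH)
        show "h i \<noteq> h (i + 1)" if "j < i" "i < n" for i
          using that False Suc.prems(3)[of i] by (cases "i = Suc j") auto
      qed (use Suc.prems in auto)
      ultimately show ?thesis unfolding eq by (simp add: a_minus_def)
    next
      case True
      have h_ext: "h \<in> extensional {1..n}" using hom_PiE Suc.prems(2) by (force simp: PiE_iff)
      have "h \<in> ?A"
        using True Suc.prems(1,2) h_ext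
        by (auto simp: compose_def shift_def fun_eq_iff extensional_def)
      \<comment> \<open>The shift misses only the point \<open>Suc j\<close>, so \<open>g\<close>
        and \<open>h\<close> differ there and nowhere else. As \<open>h\<close> repeats its value at
        \<open>Suc j\<close>, the map \<open>g\<close> does not; the induction hypothesis therefore
        applies to \<open>g\<close>, and \<open>h\<close> alone contributes to the fibre
        sum.\<close>
      moreover have "?y g = \<zero>" if g: "g \<in> ?A" "g \<noteq> h" for g
      proof (rule Suc.IH)
        have g_eq: "g i = h i" if "i \<noteq> Suc j" for i
        proof (cases "i \<in> {1..n}")
          case True
          have "h i = compose {1..n} g (shift n (Suc j)) i" using g(1) by simp
          then show ?thesis using True that by (simp add: compose_def shift_def)
        next
          case False
          then show ?thesis using h_ext g(1) hom_PiE[of n l] by (auto simp: PiE_iff extensional_def)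
        qed
        have "g (Suc j) \<noteq> h (Suc j)" using g_eq g(2) by (metis ext)
        then show "g i \<noteq> g (i + 1)" if "j < i" "i < n" for i
          using that g_eq[of i] g_eq[of "i + 1"] True Suc.prems(3)[of i] by (cases "i = Suc j") auto
      qed (use g Suc.prems in auto)
      ultimately have "(\<Oplus>g\<in>?A. ?y g) = ?y h"
        using y Suc.prems(2) by (intro finsum_eq_single) auto
      then show ?thesis unfolding eq using y[OF Suc.prems(2)] by (simp add: a_minus_def r_neg)
    qed
  qed
  \<comment> \<open>For \<open>j = n - 1\<close> no \<open>i\<close> satisfies
    \<open>j < i < n\<close>, so the condition on \<open>h\<close> is vacuous and every coefficient
    vanishes.\<close>
  from this[of "n - 1"] show ?thesis
    using assms(1,3) by (intro free_module_eqI[OF lin_comp_closed[OF assms(3) Psi_closed]])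
      (auto simp: free_module_simps(2) Psi_def, auto simp: free_module_simps)
qed

lemma mult_Psi_linear:
  "n \<ge> 1 \<Longrightarrow> mult_Psi n l \<in> linear_maps k (free_module k (C n l)) (free_module k (C n l))"
  by (intro lin_comp_linear_left Psi_closed)

text \<open>One direction reads off preserved coefficients, the other applies the vanishing result
  to the difference. Idempotence is contained in it: \<open>x\<close> and \<open>x Psi\<close> agree
  at nondegenerate maps.\<close>

lemma mult_Psi_eq_iff:
  assumes nl: "n \<ge> 1" "l \<ge> 1" and x: "x \<in> kC n l" and y: "y \<in> kC n l"
  shows "mult_Psi n l x = mult_Psi n l y \<longleftrightarrow> (\<forall>h\<in>C n l. nondegenerate n h \<longrightarrow> x h = y h)"
proof
  assume "mult_Psi n l x = mult_Psi n l y"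
  then show "\<forall>h\<in>C n l. nondegenerate n h \<longrightarrow> x h = y h"
    using mult_Psi_nondegenerate[OF nl x] mult_Psi_nondegenerate[OF nl y] by metis
next
  interpret F: module k "free_module k (C n l)" by (rule module_free_module)
  assume eq: "\<forall>h\<in>C n l. nondegenerate n h \<longrightarrow> x h = y h"
  have "mult_Psi n l (x \<ominus>\<^bsub>free_module k (C n l)\<^esub> y) = \<zero>\<^bsub>free_module k (C n l)\<^esub>"
    using nl x y eq by (intro mult_Psi_degenerate) (auto simp: free_module_minus minus_eq_zero_iff)
  then have "mult_Psi n l x \<ominus>\<^bsub>free_module k (C n l)\<^esub> mult_Psi n l y = \<zero>\<^bsub>free_module k (C n l)\<^esub>"
    using linear_maps_minus[OF F.module_axioms F.module_axioms mult_Psi_linear[OF nl(1)] x y] by simp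
  then show "mult_Psi n l x = mult_Psi n l y"
    using linear_mapsD(1)[OF mult_Psi_linear[OF nl(1)]] x y F.minus_eq_zero_iff by auto
qed

lemma mult_Psi_eq_zero_iff:
  assumes nl: "n \<ge> 1" "l \<ge> 1" and x: "x \<in> kC n l"
  shows "mult_Psi n l x = \<zero>\<^bsub>free_module k (C n l)\<^esub> \<longleftrightarrow> (\<forall>h\<in>C n l. nondegenerate n h \<longrightarrow> x h = \<zero>)"
proof -
  interpret F: module k "free_module k (C n l)" by (rule module_free_module)
  have "mult_Psi n l \<zero>\<^bsub>free_module k (C n l)\<^esub> = \<zero>\<^bsub>free_module k (C n l)\<^esub>"
    by (rule linear_maps_zero[OF F.module_axioms F.module_axioms mult_Psi_linear[OF nl(1)]])
  then show ?thesis
    using mult_Psi_eq_iff[OF nl x F.zero_closed] by (simp add: free_module_simps(2))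
qed

section \<open>The module generated by \<open>Psi\<close> and the standard module\<close>

lemma Psi_module_eq:
  "Psi_module k C n = sub_cat_module (representable k C n) (\<lambda>l. mult_Psi n l ` carrier (obj (representable k C n) l))"
  by (simp add: Psi_module_def setcompr_eq_image)

context
  fixes n :: nat
  assumes n: "n \<ge> 1"
begin

lemma mult_Psi_hom: "mult_Psi n \<in> cat_module_hom k C (representable k C n) (representable k C n)"
  by (rule right_mult_hom[OF n n Psi_closed[OF n]])

lemma cat_submodule_Psi:
  "cat_submodule k C (representable k C n) (\<lambda>l. mult_Psi n l ` carrier (obj (representable k C n) l))"
  by (rule cat_submodule_image[OF is_cat_module_representable[OF n] is_cat_module_representable[OF n] mult_Psi_hom])

lemma is_cat_module_Psi: "is_cat_module k C (Psi_module k C n)"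
  unfolding Psi_module_eq by (rule is_cat_module_sub[OF is_cat_module_representable[OF n] cat_submodule_Psi])

lemma mult_Psi_hom_Psi_module: "mult_Psi n \<in> cat_module_hom k C (representable k C n) (Psi_module k C n)"
  unfolding Psi_module_eq
  by (rule hom_into_sub[OF is_cat_module_representable[OF n] cat_submodule_Psi mult_Psi_hom]) auto

lemma Psi_module_inclusion_hom: "(\<lambda>l x. x) \<in> cat_module_hom k C (Psi_module k C n) (representable k C n)"
  unfolding Psi_module_eq by (rule sub_inclusion_hom[OF is_cat_module_representable[OF n] cat_submodule_Psi])

lemma Psi_module_carrier: "carrier (obj (Psi_module k C n) l) = mult_Psi n l ` kC n l"
  by (simp add: Psi_module_eq sub_cat_module_def)

lemma Psi_module_zero: "\<zero>\<^bsub>obj (Psi_module k C n) l\<^esub> = \<zero>\<^bsub>free_module k (C n l)\<^esub>"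
  by (simp add: Psi_module_eq sub_cat_module_def)

lemma noninjective_span_eq:
  "noninjective_span k C n l = {x \<in> kC n l. \<forall>h\<in>C n l. inj_on h {1..n} \<longrightarrow> x h = \<zero>}"
  unfolding noninjective_span_def by (subst span_basis) auto

text \<open>If \<open>f g\<close> is injective then so is \<open>g\<close>. The coefficient of
  \<open>f x\<close> at an injective map is thus a sum of coefficients of \<open>x\<close> at
  injective maps, all of them zero.\<close>

lemma cat_submodule_noninjective_span: "cat_submodule k C (representable k C n) (noninjective_span k C n)"
  unfolding cat_submodule_def
proof (intro conjI allI impI ballI)
  fix l :: nat
  have "noninjective_span k C n l = {x \<in> kC n l. \<forall>h\<in>C n l - {h. \<not> inj_on h {1..n}}. x h = \<zero>}"
    by (auto simp: noninjective_span_eq)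
  then show "submodule (noninjective_span k C n l) k (obj (representable k C n) l)"
    using supported_submodule[of "C n l" "{h. \<not> inj_on h {1..n}}"] by simp
next
  fix l m :: nat and f assume "l \<ge> 1" "m \<ge> 1" and f: "f \<in> C l m"
  have "lin_comp k C n l m (basis k (C l m) f) x h = \<zero>"
    if x: "x \<in> noninjective_span k C n l" and h: "h \<in> C n m" "inj_on h {1..n}" for x h
  proof -
    have xk: "x \<in> kC n l" using x by (simp add: noninjective_span_eq)
    have "inj_on g {1..n}" if "compose {1..n} f g = h" for g
    proof (rule inj_onI)
      fix i j assume "i \<in> {1..n}" "j \<in> {1..n}" "g i = g j"
      then show "i = j" using inj_onD[OF h(2), of i j] that by (auto simp: compose_def)
    qed
    then show ?thesis
      unfolding lin_comp_basis_left[OF xk f h(1)] using x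
      by (intro add.finprod_one_eqI) (auto simp: noninjective_span_eq)
  qed
  then show "act (representable k C n) l m f ` noninjective_span k C n l \<subseteq> noninjective_span k C n m"
    by (auto simp: noninjective_span_eq lin_comp_closed)
qed

lemma is_cat_module_standard: "is_cat_module k C (standard_module k C n)"
  unfolding standard_module_def
  by (rule is_cat_module_quot[OF is_cat_module_representable[OF n] cat_submodule_noninjective_span category])

lemma coset_hom_standard:
  "(\<lambda>l x. noninjective_span k C n l +>\<^bsub>free_module k (C n l)\<^esub> x) \<in>
    cat_module_hom k C (representable k C n) (standard_module k C n)"
  using coset_hom[OF is_cat_module_representable[OF n] cat_submodule_noninjective_span]
  by (simp add: standard_module_def)

lemma standard_module_carrier:
  "carrier (obj (standard_module k C n) l) = (\<lambda>x. noninjective_span k C n l +>\<^bsub>free_module k (C n l)\<^esub> x) ` kC n l"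
  using carrier_quot[OF is_cat_module_representable[OF n] cat_submodule_noninjective_span]
  by (simp add: standard_module_def)

lemma standard_module_zero: "\<zero>\<^bsub>obj (standard_module k C n) l\<^esub> = noninjective_span k C n l"
  by (simp add: standard_module_def quot_cat_module_def quot_module_def)

lemma submodule_noninjective_span:
  "l \<ge> 1 \<Longrightarrow> submodule (noninjective_span k C n l) k (free_module k (C n l))"
  using cat_submoduleD(1)[OF cat_submodule_noninjective_span] by simp

text \<open>Injective maps are nondegenerate, so \<open>x Psi\<close> and \<open>x\<close> have the
  same coefficients there. Hence the projection onto the standard module stays surjective on
  \<open>Psi_module\<close>, in all four categories.\<close>

lemma coset_mult_Psi:
  assumes l: "l \<ge> 1" and x: "x \<in> kC n l"
  shows "noninjective_span k C n l +>\<^bsub>free_module k (C n l)\<^esub> mult_Psi n l x =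
    noninjective_span k C n l +>\<^bsub>free_module k (C n l)\<^esub> x"
proof -
  interpret F: module k "free_module k (C n l)" by (rule module_free_module)
  have Px: "mult_Psi n l x \<in> kC n l" by (rule linear_mapsD(1)[OF mult_Psi_linear[OF n] x])
  have "mult_Psi n l x \<ominus>\<^bsub>free_module k (C n l)\<^esub> x \<in> noninjective_span k C n l"
    using x Px mult_Psi_nondegenerate[OF n l x] inj_imp_nondegenerate
    by (auto simp: noninjective_span_eq free_module_minus minus_eq_zero_iff)
  then show ?thesis
    using coset_eq_iff[OF F.module_axioms submodule_noninjective_span[OF l] Px x] by simp
qed

lemma injective_hom_from_standard:
  assumes N: "is_cat_module k C N" and \<eta>: "\<eta> \<in> cat_module_hom k C (representable k C n) N"
    and ker: "\<And>l x. l \<ge> 1 \<Longrightarrow> x \<in> kC n l \<Longrightarrow> \<eta> l x = \<zero>\<^bsub>obj N l\<^esub> \<longleftrightarrow> x \<in> noninjective_span k C n l"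
  obtains \<theta> where "\<theta> \<in> cat_module_hom k C (standard_module k C n) N"
    "\<And>l x. l \<ge> 1 \<Longrightarrow> x \<in> kC n l \<Longrightarrow>
      \<theta> l (noninjective_span k C n l +>\<^bsub>free_module k (C n l)\<^esub> x) = \<eta> l x"
    "\<And>l. l \<ge> 1 \<Longrightarrow> inj_on (\<theta> l) (carrier (obj (standard_module k C n) l))"
    "\<And>l. l \<ge> 1 \<Longrightarrow> \<theta> l ` carrier (obj (standard_module k C n) l) = \<eta> l ` kC n l"
proof -
  have "\<eta> l x = \<zero>\<^bsub>obj N l\<^esub> \<longleftrightarrow> x \<in> noninjective_span k C n l"
    if "l \<ge> 1" "x \<in> carrier (obj (representable k C n) l)" for l x
    using that ker by simp
  from injective_hom_from_quot[OF is_cat_module_representable[OF n] cat_submodule_noninjective_span N \<eta> this,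
      folded standard_module_def, unfolded representable_simps]
  show thesis using that by blast
qed

text \<open>Under \<open>inj\<close> the kernel of multiplication by \<open>Psi\<close> is exactly
  the noninjective span, so the homomorphism theorem gives the isomorphism.\<close>

lemma standard_iso_Psi_and_projective:
  assumes inj: "\<And>l h. l \<ge> 1 \<Longrightarrow> h \<in> C n l \<Longrightarrow> nondegenerate n h \<Longrightarrow> inj_on h {1..n}"
  shows "cat_module_iso k C (standard_module k C n) (Psi_module k C n)"
    and "projective TYPE('b) TYPE('c) k C (standard_module k C n)"
proof -
  have nondeg: "nondegenerate n h \<longleftrightarrow> inj_on h {1..n}" if "l \<ge> 1" "h \<in> C n l" for l h
    using inj[OF that] inj_imp_nondegenerate by blast
  have ker: "mult_Psi n l x = \<zero>\<^bsub>obj (Psi_module k C n) l\<^esub> \<longleftrightarrow> x \<in> noninjective_span k C n l"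
    if "l \<ge> 1" "x \<in> kC n l" for l x
    using that by (simp add: noninjective_span_eq Psi_module_zero mult_Psi_eq_zero_iff[OF n] nondeg[OF that(1)])
  obtain \<theta> where hom: "\<theta> \<in> cat_module_hom k C (standard_module k C n) (Psi_module k C n)"
    and \<theta>: "\<And>l x. l \<ge> 1 \<Longrightarrow> x \<in> kC n l \<Longrightarrow>
      \<theta> l (noninjective_span k C n l +>\<^bsub>free_module k (C n l)\<^esub> x) = mult_Psi n l x"
    and bij: "\<And>l. l \<ge> 1 \<Longrightarrow> inj_on (\<theta> l) (carrier (obj (standard_module k C n) l))"
      "\<And>l. l \<ge> 1 \<Longrightarrow> \<theta> l ` carrier (obj (standard_module k C n) l) = mult_Psi n l ` kC n l"
    using injective_hom_from_standard[OF is_cat_module_Psi mult_Psi_hom_Psi_module ker] by blast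
  show "cat_module_iso k C (standard_module k C n) (Psi_module k C n)"
    using hom bij is_cat_module_standard is_cat_module_Psi
    unfolding cat_module_iso_def bij_betw_def Psi_module_carrier by blast
  show "projective TYPE('b) TYPE('c) k C (standard_module k C n)"
  \<comment> \<open>The section sends the coset of \<open>x\<close> to \<open>x Psi\<close>, which
    lies in that coset again by \<open>coset_mult_Psi\<close>.\<close>
  proof (rule projective_retract[OF projective_representable[OF n] is_cat_module_standard _ coset_hom_standard])
    show "\<theta> \<in> cat_module_hom k C (standard_module k C n) (representable k C n)"
      using cat_module_hom_comp[OF hom Psi_module_inclusion_hom] by simp
  qed (auto simp: standard_module_carrier \<theta> coset_mult_Psi)
qed

end

section \<open>The short exact sequence\<close>

text \<open>Precomposition with \<open>wrap\<close> is a bijection from the injective maps on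
  \<open>[n - 1]\<close> to the maps on \<open>[n]\<close> that are nondegenerate but not injective.
  Its image is described by \<open>factor\<close>, which is where the hypothesis
  \<open>nondeg\<close> enters.\<close>

lemma short_exact_standard_Psi:
  assumes n: "n \<ge> 3" and wrap: "wrap n \<in> C n (n - 1)"
    and nondeg: "\<And>l h. l \<ge> 1 \<Longrightarrow> h \<in> C n l \<Longrightarrow> nondegenerate n h \<Longrightarrow> \<not> inj_on h {1..n} \<Longrightarrow>
      h n = h 1 \<and> inj_on h {1..n - 1}"
  shows "\<exists>\<alpha> \<beta>. short_exact k C (standard_module k C (n - 1)) (Psi_module k C n) (standard_module k C n) \<alpha> \<beta>"
proof -
  have n1: "n \<ge> 1" "n - 1 \<ge> 1" using n by auto
  define \<mu> where "\<mu> = (\<lambda>l x. lin_comp k C n (n - 1) l x (basis k (C n (n - 1)) (wrap n)))"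
  have \<mu>_hom: "\<mu> \<in> cat_module_hom k C (representable k C (n - 1)) (representable k C n)"
    unfolding \<mu>_def by (rule right_mult_hom[OF n1 basis_closed])
  have \<mu>_closed: "\<mu> l x \<in> kC n l" if "x \<in> kC (n - 1) l" for l x
    unfolding \<mu>_def by (rule lin_comp_closed[OF that basis_closed])
  have wrap_simps: "wrap n n = 1" "\<And>j. 1 \<le> j \<Longrightarrow> j < n \<Longrightarrow> wrap n j = j"
    using n by (auto simp: wrap_def)
  have wrap_cancel: "g = g'" if "g \<in> C (n - 1) l" "g' \<in> C (n - 1) l"
    "compose {1..n} g (wrap n) = compose {1..n} g' (wrap n)" for g g' l
  proof (rule PiE_ext[of g "{1..n - 1}" "\<lambda>_. {1..l}"])
    fix j assume "j \<in> {1..n - 1}"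
    then have j: "1 \<le> j" "j < n" using n by auto
    have "compose {1..n} g (wrap n) j = compose {1..n} g' (wrap n) j" using that(3) by simp
    then show "g j = g' j" using j n by (auto simp: compose_def wrap_simps)
  qed (use that hom_PiE[of "n - 1" l] in blast)+
  have \<mu>_wrap: "\<mu> l x (compose {1..n} g (wrap n)) = x g"
    if l: "l \<ge> 1" and x: "x \<in> kC (n - 1) l" and g: "g \<in> C (n - 1) l" for l x g
  proof -
    have "{g' \<in> C (n - 1) l. compose {1..n} g' (wrap n) = compose {1..n} g (wrap n)} = {g}"
      using g wrap_cancel by blast
    then show ?thesis
      using lin_comp_basis_right[OF x wrap comp_closed[OF n1 l wrap g]] x g by (simp add: \<mu>_def)
  qed
  have not_inj: "\<not> inj_on (compose {1..n} g (wrap n)) {1..n}" for g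
  proof
    assume "inj_on (compose {1..n} g (wrap n)) {1..n}"
    moreover have "compose {1..n} g (wrap n) 1 = compose {1..n} g (wrap n) n"
      using n by (simp add: compose_def wrap_simps)
    ultimately show False using n by (auto dest: inj_onD)
  qed
  have \<mu>_inj: "\<mu> l x h = \<zero>" if x: "x \<in> kC (n - 1) l" and h: "h \<in> C n l" "inj_on h {1..n}" for l x h
  proof -
    have "{g \<in> C (n - 1) l. compose {1..n} g (wrap n) = h} = {}" using not_inj h(2) by auto
    then show ?thesis using lin_comp_basis_right[OF x wrap h(1)] by (simp only: \<mu>_def finsum_empty)
  qed
  have wrap_nondeg: "nondegenerate n (compose {1..n} g (wrap n))" if "inj_on g {1..n - 1}" for g
    unfolding nondegenerate_def
  proof safe
    fix i assume i: "1 \<le> i" "i < n" "compose {1..n} g (wrap n) i = compose {1..n} g (wrap n) (i + 1)"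
    show False
    proof (cases "i + 1 = n")
      case True
      then have "g i = g 1" using i n by (simp add: compose_def wrap_simps)
      \<comment> \<open>Here \<open>i = n - 1\<close> differs from \<open>1\<close> because of
        \<open>n \<ge> 3\<close>; for \<open>n = 2\<close> the map \<open>wrap\<close> is constant
        and so is the composite.\<close>
      then show False using inj_onD[OF that, of i 1] i n True by auto
    next
      case False
      then have "g i = g (i + 1)" using i n False by (simp add: compose_def wrap_simps)
      moreover have "i + 1 \<le> n - 1" using i(2) False by linarith
      ultimately show False using inj_onD[OF that, of i "i + 1"] i(1) by simp
    qed
  qed
  have factor: "\<exists>g\<in>C (n - 1) l. inj_on g {1..n - 1} \<and> h = compose {1..n} g (wrap n)"
    if l: "l \<ge> 1" and h: "h \<in> C n l" "nondegenerate n h" "\<not> inj_on h {1..n}" for l h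
  proof -
    have hn: "h n = h 1" "inj_on h {1..n - 1}" using nondeg[OF l h] by auto
    \<comment> \<open>\<open>coface n n\<close> is the inclusion of \<open>[n - 1]\<close> into
      \<open>[n]\<close>. Writing the restriction of \<open>h\<close> as a composite with it shows
      that the restriction belongs to \<open>C\<close>.\<close>
    have "coface n n \<in> OA (n - 1) n" by (auto simp: OA_def coface_def mono_on_def)
    then have c: "coface n n \<in> C (n - 1) n" using OA_subset by blast
    let ?g = "compose {1..n - 1} h (coface n n)"
    have g: "?g j = h j" if "j \<in> {1..n - 1}" for j
      using that by (auto simp: compose_def coface_def)
    have "h = compose {1..n} ?g (wrap n)"
    proof
      fix j show "h j = compose {1..n} ?g (wrap n) j"
      proof (cases "j \<in> {1..n}")
        case True
        then show ?thesis using g hn(1) n by (cases "j = n") (auto simp: compose_def[of "{1..n}"] wrap_simps)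
      next
        case False
        then show ?thesis using hom_PiE h(1) by (force simp: compose_def PiE_iff extensional_def)
      qed
    qed
    moreover have "inj_on ?g {1..n - 1}" using hn(2) g by (simp add: inj_on_def)
    moreover have "?g \<in> C (n - 1) l" by (rule comp_closed[OF n1(2,1) l c h(1)])
    ultimately show ?thesis by blast
  qed
  let ?\<zeta> = "\<lambda>l x. mult_Psi n l (\<mu> l x)"
  have \<zeta>_hom: "?\<zeta> \<in> cat_module_hom k C (representable k C (n - 1)) (Psi_module k C n)"
    by (rule cat_module_hom_comp[OF \<mu>_hom mult_Psi_hom_Psi_module[OF n1(1)]])
  have ker_\<zeta>: "?\<zeta> l x = \<zero>\<^bsub>obj (Psi_module k C n) l\<^esub> \<longleftrightarrow> x \<in> noninjective_span k C (n - 1) l"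
    if l: "l \<ge> 1" and x: "x \<in> kC (n - 1) l" for l x
  proof -
    have "?\<zeta> l x = \<zero>\<^bsub>obj (Psi_module k C n) l\<^esub> \<longleftrightarrow> (\<forall>h\<in>C n l. nondegenerate n h \<longrightarrow> \<mu> l x h = \<zero>)"
      using mult_Psi_eq_zero_iff[OF n1(1) l \<mu>_closed[OF x]] by (simp add: Psi_module_zero[OF n1(1)])
    \<comment> \<open>At an injective \<open>h\<close> the coefficient of \<mu> applied to
      \<open>x\<close> is zero; at \<open>g wrap\<close> it is \<open>x g\<close>. By
      \<open>factor\<close>, nothing else is nondegenerate.\<close>
    also have "\<dots> \<longleftrightarrow> (\<forall>g\<in>C (n - 1) l. inj_on g {1..n - 1} \<longrightarrow> x g = \<zero>)"
    proof safe
      fix g assume "\<forall>h\<in>C n l. nondegenerate n h \<longrightarrow> \<mu> l x h = \<zero>" "g \<in> C (n - 1) l" "inj_on g {1..n - 1}"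
      then show "x g = \<zero>"
        using \<mu>_wrap[OF l x] wrap_nondeg comp_closed[OF n1 l wrap] by metis
    next
      fix h assume "\<forall>g\<in>C (n - 1) l. inj_on g {1..n - 1} \<longrightarrow> x g = \<zero>" "h \<in> C n l" "nondegenerate n h"
      then show "\<mu> l x h = \<zero>"
        using factor[OF l, of h] \<mu>_inj[OF x, of h] \<mu>_wrap[OF l x] by (cases "inj_on h {1..n}") auto
    qed
    finally show ?thesis using x by (simp add: noninjective_span_eq[OF n1(2)])
  qed
  obtain \<alpha> where \<alpha>: "\<alpha> \<in> cat_module_hom k C (standard_module k C (n - 1)) (Psi_module k C n)"
      "\<And>l x. l \<ge> 1 \<Longrightarrow> x \<in> kC (n - 1) l \<Longrightarrow>
        \<alpha> l (noninjective_span k C (n - 1) l +>\<^bsub>free_module k (C (n - 1) l)\<^esub> x) = ?\<zeta> l x"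
      "\<And>l. l \<ge> 1 \<Longrightarrow> inj_on (\<alpha> l) (carrier (obj (standard_module k C (n - 1)) l))"
      "\<And>l. l \<ge> 1 \<Longrightarrow> \<alpha> l ` carrier (obj (standard_module k C (n - 1)) l) = ?\<zeta> l ` kC (n - 1) l"
    using injective_hom_from_standard[OF n1(2) is_cat_module_Psi[OF n1(1)] \<zeta>_hom ker_\<zeta>] by blast
  define \<beta> where "\<beta> = (\<lambda>l x. noninjective_span k C n l +>\<^bsub>free_module k (C n l)\<^esub> x)"
  have \<beta>_hom: "\<beta> \<in> cat_module_hom k C (Psi_module k C n) (standard_module k C n)"
    unfolding \<beta>_def
    by (rule cat_module_hom_comp[OF Psi_module_inclusion_hom[OF n1(1)] coset_hom_standard[OF n1(1)]])
  have \<beta>_surj: "\<beta> l ` carrier (obj (Psi_module k C n) l) = carrier (obj (standard_module k C n) l)"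
    if "l \<ge> 1" for l
    unfolding Psi_module_carrier[OF n1(1)] standard_module_carrier[OF n1(1)] image_image \<beta>_def
    using coset_mult_Psi[OF n1(1) that] by simp
  have ker: "a_kernel (obj (Psi_module k C n) l) (obj (standard_module k C n) l) (\<beta> l) = ?\<zeta> l ` kC (n - 1) l"
    if l: "l \<ge> 1" for l
  proof -
    interpret F: module k "free_module k (C n l)" by (rule module_free_module)
    \<comment> \<open>Since \<open>x Psi\<close> and \<open>x\<close> share their coset, membership
      in the kernel can be tested on \<open>x\<close>.\<close>
    have "\<beta> l (mult_Psi n l x) = \<zero>\<^bsub>obj (standard_module k C n) l\<^esub> \<longleftrightarrow>
        (\<forall>h\<in>C n l. inj_on h {1..n} \<longrightarrow> x h = \<zero>)" if "x \<in> kC n l" for x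
      using coset_mult_Psi[OF n1(1) l that] that
        submodule_mem_iff_coset[OF F.module_axioms submodule_noninjective_span[OF n1(1) l] that]
      by (simp add: standard_module_zero[OF n1(1)] \<beta>_def) (simp add: noninjective_span_eq[OF n1(1)])
    then have "a_kernel (obj (Psi_module k C n) l) (obj (standard_module k C n) l) (\<beta> l) =
        mult_Psi n l ` {x \<in> kC n l. \<forall>h\<in>C n l. inj_on h {1..n} \<longrightarrow> x h = \<zero>}"
      by (auto simp: a_kernel_def' Psi_module_carrier[OF n1(1)])
    also have "\<dots> = ?\<zeta> l ` kC (n - 1) l"
    proof (intro equalityI image_subsetI)
      fix x assume "x \<in> {x \<in> kC n l. \<forall>h\<in>C n l. inj_on h {1..n} \<longrightarrow> x h = \<zero>}"
      then have x: "x \<in> kC n l" "\<And>h. h \<in> C n l \<Longrightarrow> inj_on h {1..n} \<Longrightarrow> x h = \<zero>" by auto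
      \<comment> \<open>Read off the coefficients of \<open>x\<close> along \<open>wrap\<close>.
        Then \<open>x\<close> and the image of \<open>?y\<close> under \<mu> agree at every
        nondegenerate map: both vanish at the injective ones and coincide at the composites with
        \<open>wrap\<close>. Degenerate coefficients may differ, but \<open>Psi\<close> ignores
        them.\<close>
      let ?y = "\<lambda>g\<in>C (n - 1) l. x (compose {1..n} g (wrap n))"
      have y: "?y \<in> kC (n - 1) l"
        using x(1) comp_closed[OF n1 l wrap] by (auto simp: free_module_simps)
      have "mult_Psi n l x = ?\<zeta> l ?y"
        unfolding mult_Psi_eq_iff[OF n1(1) l x(1) \<mu>_closed[OF y]]
      proof (intro ballI impI)
        fix h assume h: "h \<in> C n l" "nondegenerate n h"
        show "x h = \<mu> l ?y h"
        proof (cases "inj_on h {1..n}")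
          case True
          then show ?thesis using x(2) \<mu>_inj[OF y] h by simp
        next
          case False
          then obtain g where "g \<in> C (n - 1) l" "h = compose {1..n} g (wrap n)"
            using factor[OF l h] by blast
          then show ?thesis using \<mu>_wrap[OF l y] by simp
        qed
      qed
      then show "mult_Psi n l x \<in> ?\<zeta> l ` kC (n - 1) l" using y by blast
    next
      fix x assume "x \<in> kC (n - 1) l"
      then show "?\<zeta> l x \<in> mult_Psi n l ` {x \<in> kC n l. \<forall>h\<in>C n l. inj_on h {1..n} \<longrightarrow> x h = \<zero>}"
        using \<mu>_closed \<mu>_inj by blast
    qed
    finally show ?thesis .
  qed
  have "short_exact k C (standard_module k C (n - 1)) (Psi_module k C n) (standard_module k C n) \<alpha> \<beta>"
    unfolding short_exact_def
    using is_cat_module_standard[OF n1(2)] is_cat_module_Psi[OF n1(1)] is_cat_module_standard[OF n1(1)]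
      \<alpha> \<beta>_hom \<beta>_surj ker by simp
  then show ?thesis by blast
qed

end

section \<open>The four categories\<close>

text \<open>
  A map of \<open>CA\<close> lifts to a monotone \<open>F : \<int> \<rightarrow> \<int>\<close> with \<open>F (x + m) = F x + n\<close>; reversing maps have
  antitone lifts, which the sign \<open>s \<in> {1, -1}\<close> records.
\<close>

definition cyclic_lift :: "int \<Rightarrow> nat \<Rightarrow> nat \<Rightarrow> (nat \<Rightarrow> nat) \<Rightarrow> (int \<Rightarrow> int) \<Rightarrow> bool" where
  "cyclic_lift s m n f F \<longleftrightarrow>
     (\<forall>x y. x \<le> y \<longrightarrow> s * F x \<le> s * F y) \<and>
     (\<forall>x. F (x + int m) = F x + s * int n) \<and>
     (\<forall>i\<in>{1..m}. int n dvd F (int i) - int (f i))"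

lemma cyclic_lift_shift:
  assumes "cyclic_lift s m n f F"
  shows "F (x + a * int m) = F x + a * (s * int n)"
proof (induction a rule: int_induct[where k = 0])
  case (step1 i)
  have "F (x + (i + 1) * int m) = F ((x + i * int m) + int m)" by (simp add: algebra_simps)
  also have "\<dots> = F (x + i * int m) + s * int n" using assms unfolding cyclic_lift_def by blast
  finally show ?case using step1 by (simp add: algebra_simps)
next
  case (step2 i)
  have "F (x + i * int m) = F ((x + (i - 1) * int m) + int m)" by (simp add: algebra_simps)
  also have "\<dots> = F (x + (i - 1) * int m) + s * int n" using assms unfolding cyclic_lift_def by blast
  finally show ?case using step2 by (simp add: algebra_simps)
qed simp

lemma cyclic_lift_cong:
  assumes "cyclic_lift s m n f F" "int m dvd x - y"
  shows "int n dvd F x - F y"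
proof -
  obtain a where "x = y + a * int m" using assms(2) by (auto simp: dvd_def algebra_simps)
  then have "F x - F y = int n * (a * s)"
    using cyclic_lift_shift[OF assms(1), of y a] by (simp add: algebra_simps)
  then show ?thesis by simp
qed

text \<open>Lifts are introduced for this closure property: signs multiply, and no rotation has to
  be moved past a monotone map. It is what makes \<open>CA\<close> and \<open>SA\<close>
  categories.\<close>

lemma cyclic_lift_compose:
  assumes F: "cyclic_lift s l m f F" and G: "cyclic_lift t m n g G"
    and f: "f \<in> {1..l} \<rightarrow> {1..m}" and s: "s \<in> {1, -1}"
  shows "cyclic_lift (s * t) l n (compose {1..l} g f) (\<lambda>x. G (F x))"
  unfolding cyclic_lift_def
proof (intro conjI allI impI ballI)
  fix x y :: int assume "x \<le> y"
  then have "s * F x \<le> s * F y" using F by (simp add: cyclic_lift_def)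
  then show "s * t * G (F x) \<le> s * t * G (F y)"
    using s G by (auto simp: cyclic_lift_def)
next
  fix x
  have "F (x + int l) = F x + s * int m" using F by (simp add: cyclic_lift_def)
  then show "G (F (x + int l)) = G (F x) + s * t * int n"
    using cyclic_lift_shift[OF G, of "F x" s] by (simp add: algebra_simps)
next
  fix i assume i: "i \<in> {1..l}"
  then have "int m dvd F (int i) - int (f i)" using F by (simp add: cyclic_lift_def)
  then have "int n dvd G (F (int i)) - G (int (f i))" by (rule cyclic_lift_cong[OF G])
  moreover have "int n dvd G (int (f i)) - int (g (f i))"
    using G i f by (auto simp: cyclic_lift_def)
  ultimately have "int n dvd (G (F (int i)) - G (int (f i))) + (G (int (f i)) - int (g (f i)))"
    by (rule dvd_add)
  then show "int n dvd G (F (int i)) - int (compose {1..l} g f i)"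
    using i by (simp add: compose_def)
qed

lemma cyclic_lift_id: "cyclic_lift 1 n n (\<lambda>i\<in>{1..n}. i) (\<lambda>x. x)"
  by (simp add: cyclic_lift_def)

section \<open>Characterisation of \<open>CA\<close> and \<open>SA\<close> by lifts\<close>

lemma eq_of_dvd_diff:
  fixes a b n :: nat
  assumes "int n dvd int a - int b" "a \<in> {1..n}" "b \<in> {1..n}"
  shows "a = b"
proof (rule ccontr)
  assume "a \<noteq> b"
  then have "int n \<le> \<bar>int a - int b\<bar>" using dvd_imp_le_int[OF _ assms(1)] by simp
  then show False using assms(2,3) by auto
qed

lemma rotation_step: "i \<in> {1..n} \<Longrightarrow> i mod n + 1 \<in> {1..n}" for n :: nat
  using mod_less_divisor[of n i] unfolding atLeastAtMost_iff by linarith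

lemma rotation_funpow:
  assumes "i \<in> {1..n}"
  shows "((\<lambda>i. i mod n + 1) ^^ r) i \<in> {1..n} \<and> int n dvd (int i + int r) - int (((\<lambda>i. i mod n + 1) ^^ r) i)"
proof (induction r)
  case (Suc r)
  let ?j = "((\<lambda>i. i mod n + 1) ^^ r) i"
  have "int ?j - int (?j mod n) = int n * int (?j div n)"
    by (metis add_diff_cancel_right' mult_div_mod_eq of_nat_add of_nat_mult)
  then have "int n dvd int ?j - int (?j mod n)" by simp
  with Suc have "int n dvd (int i + int r - int ?j) + (int ?j - int (?j mod n))" by (intro dvd_add) auto
  then have "int n dvd (int i + int (Suc r)) - int (?j mod n + 1)" by (simp add: algebra_simps)
  moreover have "?j mod n + 1 \<in> {1..n}" using Suc rotation_step by blast
  ultimately show ?case by simp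
qed (use assms in simp)

lemma rotation_PiE: "rotation n r \<in> {1..n} \<rightarrow>\<^sub>E {1..n}"
  using rotation_funpow[of _ n r] by (simp add: rotation_def PiE_iff)

lemma rotation_lift: "cyclic_lift 1 n n (rotation n r) (\<lambda>x. x + int r)"
  using rotation_funpow[of _ n r] by (auto simp: cyclic_lift_def rotation_def)

lemma rotation_0: "rotation n 0 = (\<lambda>i\<in>{1..n}. i)"
  by (simp add: rotation_def id_def)

lemma rotation_1: "rotation n 1 = (\<lambda>i\<in>{1..n}. i mod n + 1)"
  by (simp add: rotation_def One_nat_def)

lemma OA_lift:
  assumes g: "g \<in> OA m n" and m: "m \<ge> 1"
  shows "\<exists>G. cyclic_lift 1 m n g G"
proof -
  \<comment> \<open>The integers are cut into blocks of length \<open>m\<close>, one of them being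
    \<open>{1..m}\<close>; hence the offsets by one. \<rho> gives the position inside the block, and
    \<open>G\<close> raises \<open>g\<close> by \<open>n\<close> from each block to the next. It is
    monotone across blocks because \<open>g\<close> takes values in \<open>{1..n}\<close>.\<close>
  define \<rho> where "\<rho> = (\<lambda>x::int. nat ((x - 1) mod int m) + 1)"
  define G where "G = (\<lambda>x. int (g (\<rho> x)) + int n * ((x - 1) div int m))"
  have \<rho>: "\<rho> x \<in> {1..m}" for x
  proof -
    have "0 \<le> (x - 1) mod int m" "(x - 1) mod int m < int m" using m by simp_all
    then show ?thesis by (simp add: \<rho>_def nat_less_iff Suc_le_eq)
  qed
  have g\<rho>: "g (\<rho> x) \<in> {1..n}" for x using g \<rho>[of x] by (auto simp: OA_def)
  have "G x \<le> G y" if "x \<le> y" for x y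
  proof (cases "(x - 1) div int m = (y - 1) div int m")
    case True
    have "(x - 1) mod int m \<le> (y - 1) mod int m"
      using that div_mult_mod_eq[of "x - 1" "int m"] div_mult_mod_eq[of "y - 1" "int m"]
      unfolding True by linarith
    then have "\<rho> x \<le> \<rho> y" by (simp add: \<rho>_def nat_mono)
    then have "g (\<rho> x) \<le> g (\<rho> y)" using g \<rho> by (auto simp: OA_def mono_on_def)
    then show ?thesis using True by (simp add: G_def)
  next
    case False
    have "(x - 1) div int m \<le> (y - 1) div int m" using that m by (intro zdiv_mono1) auto
    with False have "(x - 1) div int m + 1 \<le> (y - 1) div int m" by simp
    then have "int n * ((x - 1) div int m + 1) \<le> int n * ((y - 1) div int m)"
      by (rule mult_left_mono) simp
    then show ?thesis using g\<rho>[of x] by (simp add: G_def algebra_simps)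
  qed
  moreover have "G (x + int m) = G x + int n" for x
  proof -
    have "x + int m - 1 = (x - 1) + int m" by simp
    then have "(x + int m - 1) mod int m = (x - 1) mod int m"
      "(x + int m - 1) div int m = (x - 1) div int m + 1"
      using m by (simp_all only: mod_add_self2 div_add_self2)
    then show ?thesis by (simp add: G_def \<rho>_def algebra_simps)
  qed
  moreover have "G (int i) = int (g i)" if "i \<in> {1..m}" for i
  proof -
    have "(int i - 1) mod int m = int i - 1" "(int i - 1) div int m = 0" using that by auto
    then show ?thesis using that by (simp add: G_def \<rho>_def nat_diff_distrib)
  qed
  ultimately have "cyclic_lift 1 m n g G" by (simp add: cyclic_lift_def)
  then show ?thesis by blast
qed

lemma CA_PiE: "CA m n \<subseteq> {1..m} \<rightarrow>\<^sub>E {1..n}"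
  using rotation_PiE[of n] rotation_PiE[of m]
  by (fastforce simp: CA_def OA_def compose_def PiE_iff extensional_def)

text \<open>
  For the converse inclusion, choose \<open>x\<^sub>0\<close> minimal with \<open>F x\<^sub>0 \<ge> 1\<close>; then \<open>F\<close> maps \<open>{x\<^sub>0..x\<^sub>0 + m - 1}\<close>
  monotonically into \<open>{1..n}\<close>.
\<close>

lemma CA_iff_lift:
  assumes m: "m \<ge> 1" and n: "n \<ge> 1"
  shows "f \<in> CA m n \<longleftrightarrow> f \<in> {1..m} \<rightarrow>\<^sub>E {1..n} \<and> (\<exists>F. cyclic_lift 1 m n f F)"
proof (intro iffI conjI)
  assume f: "f \<in> CA m n"
  then show "f \<in> {1..m} \<rightarrow>\<^sub>E {1..n}" using CA_PiE by blast
  obtain r s g where g: "g \<in> OA m n"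
    and fg: "f = compose {1..m} (rotation n s) (compose {1..m} g (rotation m r))"
    using f by (auto simp: CA_def)
  obtain G where "cyclic_lift 1 m n g G" using OA_lift[OF g m] by blast
  moreover have "rotation m r \<in> {1..m} \<rightarrow> {1..m}" using rotation_PiE by blast
  ultimately have *: "cyclic_lift (1 * 1) m n (compose {1..m} g (rotation m r)) (\<lambda>x. G (x + int r))"
    using cyclic_lift_compose[OF rotation_lift] by blast
  have "compose {1..m} g (rotation m r) \<in> {1..m} \<rightarrow> {1..n}"
    using g rotation_PiE[of m r] by (auto simp: compose_def OA_def)
  from cyclic_lift_compose[OF * rotation_lift this]
  show "\<exists>F. cyclic_lift 1 m n f F" unfolding fg by auto
next
  assume "f \<in> {1..m} \<rightarrow>\<^sub>E {1..n} \<and> (\<exists>F. cyclic_lift 1 m n f F)"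
  then obtain F where f: "f \<in> {1..m} \<rightarrow>\<^sub>E {1..n}" and F: "cyclic_lift 1 m n f F" by blast
  have mono: "F x \<le> F y" if "x \<le> y" for x y using F that by (simp add: cyclic_lift_def)
  have "\<exists>x0. F x0 \<ge> 1 \<and> F (x0 - 1) \<le> 0"
  proof -
    \<comment> \<open>\<open>F\<close> changes by \<open>n \<ge> 1\<close> per period, so
      \<open>c\<close> periods in either direction suffice to pass from \<open>F 0\<close> to a
      value at most \<open>0\<close> and to a value at least \<open>1\<close>.\<close>
    define c where "c = \<bar>F 0\<bar> + 1"
    have c: "0 \<le> c" "1 - F 0 \<le> c" "F 0 \<le> c" by (auto simp: c_def)
    have cn: "c * 1 \<le> c * int n" using n c(1) by (intro mult_left_mono) auto
    define b where "b = - c * int m"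
    have b: "F b \<le> 0" using cyclic_lift_shift[OF F, of 0 "- c"] cn c(3) by (simp add: b_def)
    have d: "F (c * int m) \<ge> 1" using cyclic_lift_shift[OF F, of 0 c] cn c(2) by simp
    have "b \<le> c * int m" using mono[of "c * int m" b] b d by linarith
    then obtain t where "F (b + int t) \<ge> 1" using d by (metis zle_iff_zadd)
    then obtain t where t: "F (b + int t) \<ge> 1" "\<And>u. u < t \<Longrightarrow> F (b + int u) < 1"
      using exists_least_iff[of "\<lambda>t. F (b + int t) \<ge> 1"] by (auto simp: not_le)
    have "t \<noteq> 0" using t(1) b by (intro notI) simp
    then obtain u where u: "t = Suc u" using not0_implies_Suc by blast
    have "b + int t - 1 = b + int u" by (simp add: u)
    then have "F (b + int t - 1) \<le> 0" using t(2)[of u] u by simp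
    with t(1) show ?thesis by blast
  qed
  then obtain x0 where x0: "F x0 \<ge> 1" "F (x0 - 1) \<le> 0" by blast
  have range: "1 \<le> F (x0 + int j - 1)" "F (x0 + int j - 1) \<le> int n" if "j \<in> {1..m}" for j
  proof -
    show "1 \<le> F (x0 + int j - 1)" using mono[of x0 "x0 + int j - 1"] x0(1) that by auto
    have "F (x0 + int j - 1) \<le> F ((x0 - 1) + int m)" using that by (intro mono) auto
    also have "\<dots> = F (x0 - 1) + int n" using F unfolding cyclic_lift_def by simp
    finally show "F (x0 + int j - 1) \<le> int n" using x0(2) by simp
  qed
  define g where "g = (\<lambda>j\<in>{1..m}. nat (F (x0 + int j - 1)))"
  have "g j \<in> {1..n}" if "j \<in> {1..m}" for j using range[OF that] that by (simp add: g_def nat_le_iff le_nat_iff)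
  moreover have "g i \<le> g j" if "i \<in> {1..m}" "j \<in> {1..m}" "i \<le> j" for i j
    using that mono[of "x0 + int i - 1" "x0 + int j - 1"] by (simp add: g_def nat_mono)
  ultimately have g: "g \<in> OA m n" by (auto simp: OA_def mono_on_def g_def)
  \<comment> \<open>The source rotation by \<open>r\<close> takes \<open>i\<close> to the
    \<open>j\<close> for which \<open>x0 + j - 1\<close> is congruent to \<open>i\<close> modulo
    \<open>m\<close>, so it moves the start of the window to \<open>1\<close>. The target rotation
    can be trivial, since the choice of \<open>x0\<close> already puts the values of the window into
    \<open>{1..n}\<close>.\<close>
  define r where "r = nat ((1 - x0) mod int m)"
  have r: "int m dvd int r - (1 - x0)"
    using m by (simp add: r_def mod_eq_dvd_iff[symmetric])
  have "f = compose {1..m} (rotation n 0) (compose {1..m} g (rotation m r))"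
  proof
    fix i
    show "f i = compose {1..m} (rotation n 0) (compose {1..m} g (rotation m r)) i"
    proof (cases "i \<in> {1..m}")
      case False
      then show ?thesis using f by (auto simp: compose_def PiE_iff extensional_def)
    next
      case True
      let ?j = "rotation m r i"
      have j: "?j \<in> {1..m}" using True rotation_PiE[of m r] by blast
      have gj: "g ?j \<in> {1..n}" using g j by (auto simp: OA_def)
      have "int m dvd (int i + int r) - int ?j"
        using rotation_lift[of m r] True by (simp add: cyclic_lift_def)
      then have "int m dvd (int r - (1 - x0)) - ((int i + int r) - int ?j)" using r by (rule dvd_diff[rotated])
      moreover have "(int r - (1 - x0)) - ((int i + int r) - int ?j) = (x0 + int ?j - 1) - int i" by simp
      ultimately have "int n dvd F (x0 + int ?j - 1) - F (int i)" using cyclic_lift_cong[OF F] by metis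
      moreover have "int n dvd F (int i) - int (f i)" using F True by (simp add: cyclic_lift_def)
      ultimately have "int n dvd (F (x0 + int ?j - 1) - F (int i)) + (F (int i) - int (f i))"
        by (rule dvd_add)
      then have "int n dvd int (g ?j) - int (f i)" using range(1)[OF j] j by (simp add: g_def)
      then have "g ?j = f i" using gj f True by (intro eq_of_dvd_diff[of n]) auto
      then show ?thesis using True gj by (simp add: compose_def rotation_0)
    qed
  qed
  then show "f \<in> CA m n" using g by (auto simp: CA_def)
qed

lemma reversal_PiE: "reversal n \<in> {1..n} \<rightarrow>\<^sub>E {1..n}"
  by (auto simp: reversal_def)

lemma reversal_lift: "cyclic_lift (-1) n n (reversal n) (\<lambda>x. int n + 1 - x)"
  by (auto simp: cyclic_lift_def reversal_def of_nat_diff)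

lemma reversal_reversal:
  assumes "f \<in> {1..m} \<rightarrow>\<^sub>E {1..n}"
  shows "compose {1..m} (reversal n) (compose {1..m} (reversal n) f) = f"
proof
  fix i show "compose {1..m} (reversal n) (compose {1..m} (reversal n) f) i = f i"
  proof (cases "i \<in> {1..m}")
    case True
    then have "f i \<in> {1..n}" using assms by auto
    then have "1 \<le> f i" "f i \<le> n" "1 \<le> n + 1 - f i" "n + 1 - f i \<le> n" by auto
    then show ?thesis using True by (simp add: compose_def reversal_def)
  qed (use assms in \<open>auto simp: compose_def PiE_iff extensional_def\<close>)
qed

text \<open>Composition with the reversal changes the sign of a lift; the reversal is an involution,
  so this works in both directions.\<close>

lemma SA_iff_lift:
  assumes m: "m \<ge> 1" and n: "n \<ge> 1"
  shows "f \<in> SA m n \<longleftrightarrow> f \<in> {1..m} \<rightarrow>\<^sub>E {1..n} \<and> (\<exists>s\<in>{1, -1}. \<exists>F. cyclic_lift s m n f F)"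
proof (cases "f \<in> {1..m} \<rightarrow>\<^sub>E {1..n}")
  case f: True
  let ?f' = "compose {1..m} (reversal n) f"
  have f': "?f' \<in> {1..m} \<rightarrow>\<^sub>E {1..n}"
    using f reversal_PiE[of n] by (auto simp: compose_def)
  have rev: "\<exists>F'. cyclic_lift (s * (-1)) m n (compose {1..m} (reversal n) h) F'"
    if "cyclic_lift s m n h F" "h \<in> {1..m} \<rightarrow>\<^sub>E {1..n}" "s \<in> {1, -1}" for s h F
    using cyclic_lift_compose[OF that(1) reversal_lift _ that(3)] that(2) by blast
  have "?f' \<in> CA m n \<longleftrightarrow> (\<exists>F. cyclic_lift 1 m n ?f' F)"
    using f' by (simp add: CA_iff_lift[OF m n])
  also have "\<dots> \<longleftrightarrow> (\<exists>F. cyclic_lift (-1) m n f F)"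
    using rev[OF _ f', of 1] rev[OF _ f, of "-1"] by (auto simp: reversal_reversal[OF f])
  finally show ?thesis using f by (auto simp: SA_def CA_iff_lift[OF m n])
qed (auto simp: SA_def)

section \<open>The category laws and the inclusions between the four categories\<close>

lemma compose_PiE:
  "f \<in> {1..l} \<rightarrow>\<^sub>E {1..m} \<Longrightarrow> g \<in> {1..m} \<rightarrow>\<^sub>E {1..n} \<Longrightarrow> compose {1..l} g f \<in> {1..l} \<rightarrow>\<^sub>E {1..n}"
  by (auto simp: compose_def)

lemma category_CA: "category CA"
  unfolding category_def
proof (intro conjI allI impI ballI)
  fix n :: nat assume "n \<ge> 1"
  then show "(\<lambda>i\<in>{1..n}. i) \<in> CA n n" using cyclic_lift_id[of n] by (auto simp: CA_iff_lift)
next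
  fix l m n :: nat and f g assume lmn: "l \<ge> 1" "m \<ge> 1" "n \<ge> 1" and fg: "f \<in> CA l m" "g \<in> CA m n"
  obtain F G where PiE: "f \<in> {1..l} \<rightarrow>\<^sub>E {1..m}" "g \<in> {1..m} \<rightarrow>\<^sub>E {1..n}"
    and "cyclic_lift 1 l m f F" "cyclic_lift 1 m n g G"
    using fg lmn by (auto simp: CA_iff_lift)
  then have "cyclic_lift (1 * 1) l n (compose {1..l} g f) (\<lambda>x. G (F x))"
    by (intro cyclic_lift_compose) auto
  then show "compose {1..l} g f \<in> CA l n"
    using compose_PiE[OF PiE] lmn by (auto simp: CA_iff_lift)
qed

lemma category_SA: "category SA"
  unfolding category_def
proof (intro conjI allI impI ballI)
  fix n :: nat assume "n \<ge> 1"
  then show "(\<lambda>i\<in>{1..n}. i) \<in> SA n n" using cyclic_lift_id[of n] by (auto simp: SA_iff_lift)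
next
  fix l m n :: nat and f g assume lmn: "l \<ge> 1" "m \<ge> 1" "n \<ge> 1" and fg: "f \<in> SA l m" "g \<in> SA m n"
  have PiE: "f \<in> {1..l} \<rightarrow>\<^sub>E {1..m}" "g \<in> {1..m} \<rightarrow>\<^sub>E {1..n}" using fg by (auto simp: SA_def)
  obtain s t F G where st: "s \<in> {1, -1}" "t \<in> {1, -1 :: int}"
    and "cyclic_lift s l m f F" "cyclic_lift t m n g G"
    using fg lmn unfolding SA_iff_lift[OF lmn(1,2)] SA_iff_lift[OF lmn(2,3)] by blast
  then have "cyclic_lift (s * t) l n (compose {1..l} g f) (\<lambda>x. G (F x))"
    using PiE by (intro cyclic_lift_compose) auto
  moreover have "s * t \<in> {1, -1}" using st by auto
  ultimately show "compose {1..l} g f \<in> SA l n"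
    using compose_PiE[OF PiE] unfolding SA_iff_lift[OF lmn(1,3)] by blast
qed

lemma category_OA: "category OA"
  unfolding category_def
proof (intro conjI allI impI ballI)
  fix n :: nat show "(\<lambda>i\<in>{1..n}. i) \<in> OA n n" by (auto simp: OA_def mono_on_def)
next
  fix l m n :: nat and f g assume fg: "f \<in> OA l m" "g \<in> OA m n"
  have PiE: "f \<in> {1..l} \<rightarrow>\<^sub>E {1..m}" "g \<in> {1..m} \<rightarrow>\<^sub>E {1..n}" using fg by (auto simp: OA_def)
  have f: "f i \<in> {1..m}" if "i \<in> {1..l}" for i using PiE that by auto
  have "mono_on {1..l} (compose {1..l} g f)"
    using fg f by (simp add: OA_def monotone_on_def compose_def)
  then show "compose {1..l} g f \<in> OA l n" using compose_PiE[OF PiE] by (simp add: OA_def)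
qed

lemma category_BA: "category BA"
  unfolding category_def
proof (intro conjI allI impI ballI)
  fix n :: nat show "(\<lambda>i\<in>{1..n}. i) \<in> BA n n" by (auto simp: BA_def mono_on_def)
next
  fix l m n :: nat and f g assume fg: "f \<in> BA l m" "g \<in> BA m n"
  have PiE: "f \<in> {1..l} \<rightarrow>\<^sub>E {1..m}" "g \<in> {1..m} \<rightarrow>\<^sub>E {1..n}" using fg by (auto simp: BA_def)
  have f: "f i \<in> {1..m}" if "i \<in> {1..l}" for i using PiE that by auto
  have "mono_on {1..l} f \<or> antimono_on {1..l} f" "mono_on {1..m} g \<or> antimono_on {1..m} g"
    using fg by (auto simp: BA_def)
  then have "mono_on {1..l} (compose {1..l} g f) \<or> antimono_on {1..l} (compose {1..l} g f)"
    using f by (elim disjE) (simp_all add: monotone_on_def compose_def)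
  then show "compose {1..l} g f \<in> BA l n" using compose_PiE[OF PiE] by (simp add: BA_def)
qed

lemma OA_subset_BA: "OA m n \<subseteq> BA m n" by (auto simp: OA_def BA_def)

lemma OA_subset_CA: "OA m n \<subseteq> CA m n"
proof
  fix g assume g: "g \<in> OA m n"
  have "g = compose {1..m} (rotation n 0) (compose {1..m} g (rotation m 0))"
  proof
    fix i show "g i = compose {1..m} (rotation n 0) (compose {1..m} g (rotation m 0)) i"
      using g by (cases "i \<in> {1..m}") (auto simp: OA_def compose_def rotation_0 PiE_iff extensional_def)
  qed
  then show "g \<in> CA m n" using g unfolding CA_def by blast
qed

lemma CA_subset_SA: "CA m n \<subseteq> SA m n" using CA_PiE by (auto simp: SA_def)

section \<open>Nondegenerate maps in the four categories\<close>

text \<open>Rotate by one step, which puts \<open>n\<close> and \<open>1\<close> at the neighbouring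
  places \<open>1\<close> and \<open>2\<close>, then merge these by \<open>s_1\<close>.\<close>

lemma wrap_in_CA:
  assumes "n \<ge> 2"
  shows "wrap n \<in> CA n (n - 1)"
proof -
  have "codegeneracy n 1 \<in> OA n (n - 1)"
    using assms by (auto simp: OA_def codegeneracy_def mono_on_def)
  moreover have "wrap n = compose {1..n} (rotation (n - 1) 0) (compose {1..n} (codegeneracy n 1) (rotation n 1))"
  proof
    fix i
    show "wrap n i = compose {1..n} (rotation (n - 1) 0) (compose {1..n} (codegeneracy n 1) (rotation n 1)) i"
    proof (cases "i \<in> {1..n}")
      case True
      then consider "i = n" "1 \<le> n - 1" | "1 \<le> i" "i < n" "i \<le> n - 1"
        using assms unfolding atLeastAtMost_iff by linarith
      then show ?thesis
        using assms by cases (simp_all add: wrap_def compose_def rotation_0 rotation_1 codegeneracy_def)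
    qed (auto simp: wrap_def compose_def)
  qed
  ultimately show ?thesis unfolding CA_def by blast
qed

text \<open>For a monotone lift \<open>G\<close>, equal values at \<open>a < b\<close> mean that
  \<open>G b - G a\<close> is a multiple of \<open>n\<close> between \<open>0\<close> and
  \<open>n\<close>. If it is \<open>0\<close>, then \<open>G\<close> is constant from
  \<open>a\<close> to \<open>b\<close>, so \<open>f a = f (a + 1)\<close>, which is excluded. If it
  is \<open>n\<close>, then \<open>G\<close> is constant from \<open>b\<close> to
  \<open>a + m\<close>, so its values at \<open>b\<close> and \<open>b + 1\<close> agree; this is
  excluded unless \<open>b = m\<close>, where \<open>b + 1\<close> is congruent to
  \<open>1\<close>.\<close>

lemma SA_nondegenerate_repeat:
  assumes m: "m \<ge> 1" and n: "n \<ge> 1" and f: "f \<in> SA m n" and nondeg: "nondegenerate m f"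
    and ab: "1 \<le> a" "a < b" "b \<le> m" "f a = f b"
  shows "b = m \<and> f m = f 1"
proof -
  have PiE: "f \<in> {1..m} \<rightarrow>\<^sub>E {1..n}" using f by (auto simp: SA_def)
  obtain s F where s: "s \<in> {1, -1}" and F: "cyclic_lift s m n f F"
    using f unfolding SA_iff_lift[OF m n] by blast
  \<comment> \<open>Multiplying by the sign makes the lift monotone, so preserving and reversing
    maps are treated together.\<close>
  define G where "G x = s * F x" for x
  have G_mono: "G x \<le> G y" if "x \<le> y" for x y using F that by (simp add: cyclic_lift_def G_def)
  have G_shift: "G (x + int m) = G x + int n" for x
    using F s by (auto simp: cyclic_lift_def G_def algebra_simps)
  have F_eq: "F x = F y" if "G x = G y" for x y using that s by (auto simp: G_def)
  have Ff: "int n dvd F (int i) - int (f i)" if "i \<in> {1..m}" for i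
    using F that by (simp add: cyclic_lift_def)
  have f_eq: "f i = f j" if "i \<in> {1..m}" "j \<in> {1..m}" "int n dvd F (int i) - F (int j)" for i j
  proof (rule eq_of_dvd_diff)
    have "int n dvd (F (int i) - F (int j)) - (F (int i) - int (f i)) + (F (int j) - int (f j))"
      by (rule dvd_add[OF dvd_diff[OF that(3) Ff[OF that(1)]] Ff[OF that(2)]])
    then show "int n dvd int (f i) - int (f j)" by simp
  qed (use PiE that in auto)
  have "a \<in> {1..m}" "b \<in> {1..m}" using ab by auto
  then have "int n dvd (F (int b) - int (f b)) - (F (int a) - int (f a))"
    by (intro dvd_diff[OF Ff Ff])
  then have "int n dvd F (int b) - F (int a)" using ab(4) by simp
  then have "int n dvd s * (F (int b) - F (int a))" by simp
  then have "int n dvd G (int b) - G (int a)" by (simp add: G_def right_diff_distrib)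
  then obtain c where c: "G (int b) - G (int a) = int n * c" by (auto simp: dvd_def)
  have "0 \<le> int n * c" using G_mono[of "int a" "int b"] ab c by simp
  moreover have "int n * c \<le> int n * 1" using G_mono[of "int b" "int a + int m"] ab c G_shift by simp
  ultimately have "0 \<le> c" "c \<le> 1" using n by (simp_all add: zero_le_mult_iff)
  then consider "c = 0" | "c = 1" by linarith
  then show ?thesis
  proof cases
    case 1
    then have "G (int a) = G (int (a + 1))"
      using c G_mono[of "int a" "int (a + 1)"] G_mono[of "int (a + 1)" "int b"] ab by simp
    then have "F (int a) = F (int (a + 1))" by (rule F_eq)
    then have "f a = f (a + 1)" using ab by (intro f_eq) auto
    then show ?thesis using nondeg[unfolded nondegenerate_def, rule_format, of a] ab by simp
  next
    case 2
    then have b: "G (int b) = G (int b + 1)"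
      using c G_mono[of "int b" "int b + 1"] G_mono[of "int b + 1" "int a + int m"] ab G_shift by simp
    show ?thesis
    proof (cases "b = m")
      case True
      have "F (int m + 1) = F 1 + s * int n" using F by (simp add: cyclic_lift_def add.commute)
      then have "F (int m) - F (int 1) = s * int n" using F_eq[OF b] True by simp
      then have "f m = f 1" using m by (intro f_eq) auto
      then show ?thesis using True by simp
    next
      case False
      then have "f b = f (b + 1)" using F_eq[OF b] ab by (intro f_eq) (auto simp: add.commute)
      then show ?thesis using nondeg[unfolded nondegenerate_def, rule_format, of b] ab False by simp
    qed
  qed
qed

lemma SA_nondegenerate:
  assumes "m \<ge> 1" "n \<ge> 1" "f \<in> SA m n" "nondegenerate m f" "\<not> inj_on f {1..m}"
  shows "f m = f 1 \<and> inj_on f {1..m - 1}"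
proof
  note repeat = SA_nondegenerate_repeat[OF assms(1-4)]
  obtain a b where "a \<in> {1..m}" "b \<in> {1..m}" "f a = f b" "a < b"
    using assms(5) unfolding inj_on_def by (metis nat_neq_iff)
  then show "f m = f 1" using repeat[of a b] by auto
  show "inj_on f {1..m - 1}"
  proof (rule linorder_inj_onI)
    fix a b assume "a < b" "a \<in> {1..m - 1}" "b \<in> {1..m - 1}"
    moreover from this have "b < m" using assms(1) unfolding atLeastAtMost_iff by linarith
    ultimately show "f a \<noteq> f b" using repeat[of a b] by auto
  qed auto
qed

text \<open>For \<open>a < b\<close> the value at \<open>a + 1\<close> lies between those at
  \<open>a\<close> and \<open>b\<close>, so equality of the outer two would give
  \<open>f a = f (a + 1)\<close>.\<close>

lemma BA_nondegenerate:
  assumes f: "f \<in> BA m n" and nondeg: "nondegenerate m f"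
  shows "inj_on f {1..m}"
proof (rule linorder_inj_onI)
  fix a b assume ab: "a < b" "a \<in> {1..m}" "b \<in> {1..m}"
  have "a + 1 \<in> {1..m}" "a \<le> a + 1" "a + 1 \<le> b" using ab by auto
  moreover have "mono_on {1..m} f \<or> antimono_on {1..m} f" using f by (auto simp: BA_def)
  ultimately have "f a \<le> f (a + 1) \<and> f (a + 1) \<le> f b \<or> f b \<le> f (a + 1) \<and> f (a + 1) \<le> f a"
    using ab unfolding monotone_on_def by blast
  moreover have "f a \<noteq> f (a + 1)" using nondeg ab by (auto simp: nondegenerate_def)
  ultimately show "f a \<noteq> f b" by auto
qed auto

theorem proposition4p5:
  fixes k :: "('r, 'm) ring_scheme"
  assumes "cring k"
  shows "(\<forall>C\<in>{OA, BA}. \<forall>n\<ge>1.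
            cat_module_iso k C (standard_module k C n) (Psi_module k C n) \<and>
            projective TYPE('b) TYPE('c) k C (standard_module k C n)) \<and>
         (\<forall>C\<in>{CA, SA}. \<forall>n\<ge>3.
            \<exists>\<alpha> \<beta>. short_exact k C (standard_module k C (n - 1)) (Psi_module k C n)
                      (standard_module k C n) \<alpha> \<beta>)"
proof (intro conjI ballI allI impI)
  fix C and n :: nat assume C: "C \<in> {OA, BA}" and n: "n \<ge> 1"
  \<comment> \<open>Both cases run through \<open>BA\<close>: injectivity of nondegenerate maps is
    inherited by the smaller hom-sets of \<open>OA\<close>.\<close>
  have BA: "C m n \<subseteq> BA m n" for m n using C OA_subset_BA by auto
  interpret linearised_category k C
  proof (intro linearised_category.intro linearised_category_axioms.intro assms)
    show "C m n \<subseteq> {1..m} \<rightarrow>\<^sub>E {1..n}" for m n using BA by (auto simp: BA_def)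
  qed (use C category_OA category_BA OA_subset_BA in auto)
  have "inj_on h {1..n}" if "l \<ge> 1" "h \<in> C n l" "nondegenerate n h" for l h
    using BA_nondegenerate[of h n l] BA that by blast
  note * = standard_iso_Psi_and_projective[OF n this]
  show "cat_module_iso k C (standard_module k C n) (Psi_module k C n)" by (rule *(1))
  show "projective TYPE('b) TYPE('c) k C (standard_module k C n)" by (rule *(2))
next
  fix C and n :: nat assume C: "C \<in> {CA, SA}" and n: "n \<ge> 3"
  \<comment> \<open>\<open>C\<close> lies between \<open>CA\<close> and \<open>SA\<close>: the lower
    bound supplies \<open>wrap\<close>, the upper bound restricts the nondegenerate maps.\<close>
  have CA: "CA m n \<subseteq> C m n" and SA: "C m n \<subseteq> SA m n" for m n using C CA_subset_SA by auto
  interpret linearised_category k C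
  proof (intro linearised_category.intro linearised_category_axioms.intro assms)
    show "C m n \<subseteq> {1..m} \<rightarrow>\<^sub>E {1..n}" for m n using SA by (auto simp: SA_def)
    show "OA m n \<subseteq> C m n" for m n using CA OA_subset_CA by blast
  qed (use C category_CA category_SA in auto)
  have n12: "n \<ge> 1" "n \<ge> 2" using n by auto
  show "\<exists>\<alpha> \<beta>. short_exact k C (standard_module k C (n - 1)) (Psi_module k C n) (standard_module k C n) \<alpha> \<beta>"
  proof (rule short_exact_standard_Psi[OF n])
    show "wrap n \<in> C n (n - 1)" using wrap_in_CA[OF n12(2)] CA by blast
    show "h n = h 1 \<and> inj_on h {1..n - 1}"
      if "l \<ge> 1" "h \<in> C n l" "nondegenerate n h" "\<not> inj_on h {1..n}" for l h
      using SA_nondegenerate[OF n12(1) that(1) _ that(3,4)] that(2) SA by blast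
  qed
qed

end
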